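(* Let $p(z)=a_0z^n+a_1z^{n-1}+\cdots+a_n$ and $q(z)=b_0z^n+b_1z^{n-1}+\cdots+b_n$ be polynomials with real coefficients, $a_0>0$. The following are equivalent: 1) The polynomials $p$ and $q$ have only nonpositive zeros (the case $q\equiv 0$ is included), and the function $R=q/p$ is either an $R$-function of negative type or identically zero. 2) The infinite matrix of Hurwitz type $H(p,q)$ is totally nonnegative.
   Context: A rational function $R$ (considered after cancelling common factors of numerator and denominator) is called an $R$-function of negative type if it maps the upper half-plane of the complex plane to the lower half-plane: $\operatorname{Im} z>0$ implies $\operatorname{Im} R(z)<0$. Set $a_i=b_i=0$ for $i<0$ and for $i>n$. The infinite matrix of Hurwitz type $H(p,q)$ is defined as follows. If $\deg q<\deg p$ (i.e. $b_0=0$), $$H(p,q)=\begin{pmatrix} a_0&a_1&a_2&a_3&\dots\\ 0&b_1&b_2&b_3&\dots\\ 0&a_0&a_1&a_2&\dots\\ 0&0&b_1&b_2&\dots\\ \vdots&\vdots&\vdots&\vdots&\ddots\end{pmatrix},$$ i.e. the entry in row $2i-1$, column $c$ is $a_{c-i}$ and the entry in row $2i$, column $c$ is $b_{c-i}$. If $\deg q=\deg p$ (i.e. $b_0\ne 0$), $$H(p,q)=\begin{pmatrix} b_0&b_1&b_2&b_3&\dots\\ 0&a_0&a_1&a_2&\dots\\ 0&b_0&b_1&b_2&\dots\\ 0&0&a_0&a_1&\dots\\ \vdots&\vdots&\vdots&\vdots&\ddots\end{pmatrix},$$ i.e. the entry in row $2i-1$, column $c$ is $b_{c-i}$ and the entry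 in row $2i$, column $c$ is $a_{c-i-1}$. An infinite matrix is called totally nonnegative if all its minors are nonnegative.
   Formalization: The formal theorem assumes b_0 ≥ 0 and that R = q/p is not a nonzero constant; the claim fails otherwise: p=z+2, q=-z-1 satisfies 1) but not 2), and p=q=z+1 satisfies 2) but not 1). *)

theory Defs
  imports
    "HOL-Computational_Algebra.Computational_Algebra"
    "HOL-Computational_Algebra.Field_as_Ring"
    "Jordan_Normal_Form.Determinant"
begin

definition only_nonpos_zeros :: "real poly \<Rightarrow> bool" where
  "only_nonpos_zeros p \<longleftrightarrow>
     (\<forall>z::complex. poly (map_poly of_real p) z = 0 \<longrightarrow> z \<in> \<real> \<and> Re z \<le> 0)"

text \<open>
  Real rational functions are elements of the fraction field \<^typ>\<open>real poly fract\<close>;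
  \<^const>\<open>quot_of_fract\<close> returns the numerator and denominator in lowest terms.
  A value in the lower half-plane presupposes that \<open>R\<close> has no pole at \<open>z\<close>; the denominator
  condition in \<open>R_function_neg\<close> states this independently of the convention \<open>x / 0 = 0\<close>.
\<close>

definition ratfun_num :: "real poly fract \<Rightarrow> complex \<Rightarrow> complex" where
  "ratfun_num R z = poly (map_poly of_real (fst (quot_of_fract R))) z"

definition ratfun_denom :: "real poly fract \<Rightarrow> complex \<Rightarrow> complex" where
  "ratfun_denom R z = poly (map_poly of_real (snd (quot_of_fract R))) z"

definition R_function_neg :: "real poly fract \<Rightarrow> bool" where
  "R_function_neg R \<longleftrightarrow>
     (\<forall>z. Im z > 0 \<longrightarrow> ratfun_denom R z \<noteq> 0 \<and> Im (ratfun_num R z / ratfun_denom R z) < 0)"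

definition ext_coeff :: "nat \<Rightarrow> (nat \<Rightarrow> real) \<Rightarrow> int \<Rightarrow> real" where
  "ext_coeff n a k = (if 0 \<le> k \<and> k \<le> int n then a (nat k) else 0)"

text \<open>
  Rows and columns are numbered from \<open>0\<close>, so the row \<open>2 * j\<close> below is the row \<open>2 * i - 1\<close>, and
  the row \<open>2 * j + 1\<close> is the row \<open>2 * i\<close>, of the usual numbering from \<open>1\<close> with \<open>i = j + 1\<close>.
  Only \<open>a 0, \<dots>, a n\<close> and \<open>b 0, \<dots>, b n\<close> matter.
\<close>

definition hurwitz_type_matrix ::
  "nat \<Rightarrow> (nat \<Rightarrow> real) \<Rightarrow> (nat \<Rightarrow> real) \<Rightarrow> nat \<Rightarrow> nat \<Rightarrow> real" where
  "hurwitz_type_matrix n a b r c =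
     (let j = int (r div 2); k = int c in
      if b 0 = 0
      then (if even r then ext_coeff n a (k - j) else ext_coeff n b (k - j))
      else (if even r then ext_coeff n b (k - j) else ext_coeff n a (k - j - 1)))"

definition totally_nonneg :: "(nat \<Rightarrow> nat \<Rightarrow> real) \<Rightarrow> bool" where
  "totally_nonneg M \<longleftrightarrow>
     (\<forall>k (r :: nat \<Rightarrow> nat) (c :: nat \<Rightarrow> nat).
        strict_mono_on {..<k} r \<longrightarrow> strict_mono_on {..<k} c \<longrightarrow>
        Determinant.det (mat k k (\<lambda>(i, j). M (r i) (c j))) \<ge> 0)"

end

theory Submission
  imports Defs "HOL-Complex_Analysis.Complex_Analysis"
begin

text \<open>
  In the variable \<open>t = 1 / z\<close> the rows of the matrix are the coefficient sequences of
  \<open>P, t Q, t P, t\<^sup>2 Q, \<dots>\<close>, and both conditions are compared with an expansion of \<open>Q / P\<close> into a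
  Stieltjes continued fraction with positive coefficients. Such an expansion factors the matrix
  into nonnegative bidiagonal matrices and the Toeplitz matrix of a common divisor of \<open>P\<close> and \<open>Q\<close>,
  and it determines the sign of the imaginary part of \<open>Q / P\<close>. Conversely, the coefficients of the
  fraction are quotients of minors of the matrix; and if \<open>Q / P\<close> comes from an \<open>R\<close>-function, the
  minimum principle for imaginary parts shows that every Euclidean step yields a function of the same
  kind. That a polynomial with a totally nonnegative Toeplitz matrix has only real zeros follows from
  the variation diminishing property: a nonreal zero gives a slowly oscillating sequence annihilated
  by the polynomial, which a tiny rapidly oscillating term turns into a counterexample.
\<close>

section \<open>Totally nonnegative matrices\<close>

text \<open>The fraction sees only the quotient: the divisor \<open>D\<close> cancels in
  \<open>R\<close> but stays in the matrix, so zeros need an argument of their own in each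
  direction. From the zeros, \<open>D\<close> divides \<open>P\<close> and its Toeplitz matrix
  factors over linear terms; from the matrix, the rows of one parity form the Toeplitz matrix of a
  single polynomial. The other obstacle is the real axis. The minimum principle needs a lower bound
  at every boundary point, including the poles of \<open>R\<close>. These are simple, and because
  they are nonpositive, \<open>z R\<close> satisfies the bound; this gives the second sign condition
  of a Stieltjes function. The two shapes of the matrix are treated as one. With
  \<open>c = b 0 / a 0\<close> and \<open>B = c A + t Q\<close>, where \<open>A\<close> and
  \<open>B\<close> are the reversed \<open>p\<close> and \<open>q\<close>, the case
  \<open>b 0 = 0\<close> belongs to the pair \<open>(A, Q)\<close>, and \<open>b 0 > 0\<close> is
  one further step of the fraction.\<close>

definition minor_det :: "(nat \<Rightarrow> nat \<Rightarrow> real) \<Rightarrow> nat \<Rightarrow> (nat \<Rightarrow> nat) \<Rightarrow> (nat \<Rightarrow> nat) \<Rightarrow> real" where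
  "minor_det M k r c = Determinant.det (Matrix.mat k k (\<lambda>(i, j). M (r i) (c j)))"

lemma totally_nonneg_alt:
  "totally_nonneg M \<longleftrightarrow>
     (\<forall>k r c. strict_mono_on {..<k} r \<longrightarrow> strict_mono_on {..<k} c \<longrightarrow> minor_det M k r c \<ge> 0)"
  by (simp add: totally_nonneg_def minor_det_def)

lemma totally_nonnegD:
  "totally_nonneg M \<Longrightarrow> strict_mono_on {..<k} r \<Longrightarrow> strict_mono_on {..<k} c \<Longrightarrow> minor_det M k r c \<ge> 0"
  by (simp add: totally_nonneg_alt)

lemma totally_nonneg_reindex:
  assumes "totally_nonneg M" "strict_mono f" "strict_mono g"
  shows "totally_nonneg (\<lambda>i j. M (f i) (g j))"
  unfolding totally_nonneg_alt
proof (intro allI impI)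
  fix k and r c :: "nat \<Rightarrow> nat" assume "strict_mono_on {..<k} r" "strict_mono_on {..<k} (c :: nat \<Rightarrow> nat)"
  then have "minor_det M k (\<lambda>i. f (r i)) (\<lambda>j. g (c j)) \<ge> 0"
    using assms by (intro totally_nonnegD) (auto simp: strict_mono_on_def strict_mono_def)
  then show "minor_det (\<lambda>i j. M (f i) (g j)) k r c \<ge> 0"
    by (simp add: minor_det_def)
qed

section \<open>Minors under nonnegative combinations of rows\<close>

lemma det_mat_sum_rows:
  fixes g :: "nat \<Rightarrow> 'b \<Rightarrow> nat \<Rightarrow> 'a :: comm_ring_1"
  assumes "\<And>i. i < k \<Longrightarrow> finite (S i)"
  shows "Determinant.det (Matrix.mat k k (\<lambda>(i, j). \<Sum>s\<in>S i. g i s j)) =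
    (\<Sum>f\<in>PiE {0..<k} S. Determinant.det (Matrix.mat k k (\<lambda>(i, j). g i (f i) j)))"
proof -
  have "(\<Prod>i = 0..<k. Matrix.mat k k (\<lambda>(i, j). \<Sum>s\<in>S i. g i s j) $$ (i, p i)) =
      (\<Sum>f\<in>PiE {0..<k} S. \<Prod>i = 0..<k. Matrix.mat k k (\<lambda>(i, j). g i (f i) j) $$ (i, p i))"
    if p: "p permutes {0..<k}" for p
  proof -
    have pk: "p i < k" if "i < k" for i using p that permutes_in_image[OF p, of i] by auto
    have "(\<Prod>i = 0..<k. Matrix.mat k k (\<lambda>(i, j). \<Sum>s\<in>S i. g i s j) $$ (i, p i)) =
      (\<Prod>i = 0..<k. \<Sum>s\<in>S i. g i s (p i))"
      using pk by (intro prod.cong) auto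
    also have "\<dots> = (\<Sum>f\<in>PiE {0..<k} S. \<Prod>i = 0..<k. g i (f i) (p i))"
      using assms by (intro prod_sum_PiE) auto
    also have "\<dots> = (\<Sum>f\<in>PiE {0..<k} S. \<Prod>i = 0..<k. Matrix.mat k k (\<lambda>(i, j). g i (f i) j) $$ (i, p i))"
      using pk by (intro sum.cong prod.cong) auto
    finally show ?thesis .
  qed
  then show ?thesis
    unfolding Determinant.det_def'[OF mat_carrier]
    by (subst sum.swap) (simp add: sum_distrib_left)
qed

lemma det_mat_scale_rows:
  fixes g :: "nat \<Rightarrow> nat \<Rightarrow> 'a :: comm_ring_1"
  shows "Determinant.det (Matrix.mat k k (\<lambda>(i, j). w i * g i j)) =
    (\<Prod>i = 0..<k. w i) * Determinant.det (Matrix.mat k k (\<lambda>(i, j). g i j))"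
proof -
  have "(\<Prod>i = 0..<k. Matrix.mat k k (\<lambda>(i, j). w i * g i j) $$ (i, p i)) =
      (\<Prod>i = 0..<k. w i) * (\<Prod>i = 0..<k. Matrix.mat k k (\<lambda>(i, j). g i j) $$ (i, p i))"
    if p: "p permutes {0..<k}" for p
  proof -
    have pk: "p i < k" if "i < k" for i using p that permutes_in_image[OF p, of i] by auto
    show ?thesis unfolding prod.distrib[symmetric] using pk by (intro prod.cong) auto
  qed
  then show ?thesis
    unfolding Determinant.det_def'[OF mat_carrier]
    by (simp add: sum_distrib_left mult_ac)
qed

text \<open>Multilinearity writes a minor of the merged matrix as a nonnegative combination of
  determinants of \<open>M\<close> with rows \<open>f\<close>. By \<open>ord\<close> each
  \<open>f\<close> is weakly increasing, so it gives a genuine minor or two equal rows. As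
  \<open>s \<le> s'\<close> may be an equality, neighbouring groups may share a row, which covers
  nonnegative bidiagonal factors.\<close>

lemma totally_nonneg_merge_rows:
  assumes M: "totally_nonneg M"
    and fin: "\<And>r. finite (S r)"
    and w: "\<And>r s. s \<in> S r \<Longrightarrow> w r s \<ge> 0"
    and ord: "\<And>r r' s s'. r < r' \<Longrightarrow> s \<in> S r \<Longrightarrow> s' \<in> S r' \<Longrightarrow> s \<le> s'"
  shows "totally_nonneg (\<lambda>r c. \<Sum>s\<in>S r. w r s * M s c)"
  unfolding totally_nonneg_alt
proof (intro allI impI)
  fix k and r c :: "nat \<Rightarrow> nat" assume r: "strict_mono_on {..<k} r" and c: "strict_mono_on {..<k} (c :: nat \<Rightarrow> nat)"
  have "minor_det (\<lambda>r c. \<Sum>s\<in>S r. w r s * M s c) k r c =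
     (\<Sum>f\<in>PiE {0..<k} (\<lambda>i. S (r i)). (\<Prod>i = 0..<k. w (r i) (f i)) * minor_det M k f c)"
    unfolding minor_det_def using fin by (subst det_mat_sum_rows) (auto simp: det_mat_scale_rows)
  also have "\<dots> \<ge> 0"
  proof (intro sum_nonneg mult_nonneg_nonneg prod_nonneg ballI)
    fix f i assume "f \<in> PiE {0..<k} (\<lambda>i. S (r i))" "i \<in> {0..<k}"
    then show "w (r i) (f i) \<ge> 0" using w by (auto simp: PiE_iff)
  next
    fix f assume f: "f \<in> PiE {0..<k} (\<lambda>i. S (r i))"
    have mono: "f i \<le> f j" if "i < j" "j < k" for i j
      using that f r by (intro ord[of "r i" "r j"]) (auto simp: PiE_iff strict_mono_on_def)
    show "minor_det M k f c \<ge> 0"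
    proof (cases "strict_mono_on {..<k} f")
      case True
      then show ?thesis using M c by (intro totally_nonnegD)
    next
      case False
      then obtain i j where ij: "i < j" "j < k" "f i = f j"
        using mono by (force simp: strict_mono_on_def)
      have "minor_det M k f c = 0"
        unfolding minor_det_def
        by (rule Determinant.det_identical_rows[where i = i and j = j])
          (use ij in \<open>auto intro!: eq_vecI\<close>)
      then show ?thesis by simp
    qed
  qed
  finally show "minor_det (\<lambda>r c. \<Sum>s\<in>S r. w r s * M s c) k r c \<ge> 0" .
qed

text \<open>
  Expanding the vanishing determinant of the \<open>p\<close> rows and their combination along the latter shows
  that all maximal minors of the \<open>p\<close> rows vanish; a linear relation between the rows then removes
  one of them from the combination.
\<close>

lemma totally_nonneg_no_alternation:
  assumes "totally_nonneg N"
  shows "\<not> (\<forall>i\<le>p. (-1) ^ i * (\<Sum>b<p. x b * N b i) > 0)"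
  using assms
proof (induction p arbitrary: N x)
  case 0
  then show ?case by simp
next
  case (Suc p)
  show ?case
  proof
    assume alt: "\<forall>i\<le>Suc p. (-1) ^ i * (\<Sum>b<Suc p. x b * N b i) > 0"
    define y where "y i = (\<Sum>b<Suc p. x b * N b i)" for i
    define m where "m = Suc p"
    define Z where "Z = Matrix.mat (Suc m) (Suc m) (\<lambda>(b, i). if b < m then N b i else y i)"
    have Z: "Z \<in> carrier_mat (Suc m) (Suc m)" by (simp add: Z_def)
    define v where "v = Matrix.vec (Suc m) (\<lambda>b. if b < m then x b else - 1)"
    have "v $ m = -1" by (simp add: v_def)
    then have v0: "v \<noteq> 0\<^sub>v (Suc m)" by (metis index_zero_vec(1) lessI neg_equal_0_iff_equal zero_neq_one)
    have "Z\<^sup>T *\<^sub>v v = 0\<^sub>v (Suc m)"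
      by (rule eq_vecI) (auto simp: Z_def v_def scalar_prod_def y_def m_def atLeast0LessThan mult.commute)
    then have "Determinant.det Z\<^sup>T = 0"
      using v0 Z by (subst Determinant.det_0_iff_vec_prod_zero[of _ "Suc m"]) (auto intro!: exI[of _ v] simp: v_def)
    then have "Determinant.det Z = 0" using Determinant.det_transpose[OF Z] by simp
    then have "0 = (\<Sum>i<Suc m. Z $$ (m, i) * cofactor Z m i)"
      using Determinant.laplace_expansion_row[OF Z, of m] by simp
    \<comment> \<open>The cofactor signs along the last row match the alternation of
      \<open>y\<close>: without the common factor every summand is nonnegative, so each one is
      zero.\<close>
    also have "\<dots> = (-1)^m * (\<Sum>i<Suc m. ((-1) ^ i * y i) * Determinant.det (mat_delete Z m i))"
      unfolding sum_distrib_left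
      by (intro sum.cong) (auto simp: Z_def cofactor_def power_add)
    finally have sum0: "(\<Sum>i<Suc m. ((-1) ^ i * y i) * Determinant.det (mat_delete Z m i)) = 0" by simp
    have nn: "Determinant.det (mat_delete Z m i) \<ge> 0" if "i < Suc m" for i
    proof -
      have "mat_delete Z m i = Matrix.mat m m (\<lambda>(b, j). N b (if j < i then j else Suc j))"
        using that by (intro eq_matI) (auto simp: mat_delete_def Z_def)
      then have "Determinant.det (mat_delete Z m i) = minor_det N m (\<lambda>b. b) (\<lambda>j. if j < i then j else Suc j)"
        by (simp add: minor_det_def)
      also have "\<dots> \<ge> 0" using Suc.prems by (intro totally_nonnegD) (auto simp: strict_mono_on_def)
      finally show ?thesis .
    qed
    have "\<forall>i\<in>{..<Suc m}. ((-1) ^ i * y i) * Determinant.det (mat_delete Z m i) = 0"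
    proof (subst sum_nonneg_eq_0_iff[symmetric])
      fix i assume "i \<in> {..<Suc m}"
      then show "((-1) ^ i * y i) * Determinant.det (mat_delete Z m i) \<ge> 0"
        using alt nn[of i]
        by (intro mult_nonneg_nonneg[OF less_imp_le]) (auto simp: y_def m_def less_Suc_eq_le simp del: sum.lessThan_Suc)
    qed (use sum0 in auto)
    then have "(-1) ^ m * y m * Determinant.det (mat_delete Z m m) = 0" by blast
    moreover have "(-1) ^ m * y m > 0" using alt by (auto simp: y_def m_def)
    ultimately have d0: "Determinant.det (mat_delete Z m m) = 0" by auto
    have Zm: "mat_delete Z m m = Matrix.mat m m (\<lambda>(b, j). N b j)"
      by (intro eq_matI) (auto simp: mat_delete_def Z_def)
    define W where "W = (Matrix.mat m m (\<lambda>(b, j). N b j))"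
    have W: "W \<in> carrier_mat m m" by (simp add: W_def)
    have "Determinant.det W\<^sup>T = 0" using d0 Zm Determinant.det_transpose[OF W] by (simp add: W_def)
    then obtain u where u: "u \<in> carrier_vec m" "u \<noteq> 0\<^sub>v m" "W\<^sup>T *\<^sub>v u = 0\<^sub>v m"
      using W by (subst (asm) Determinant.det_0_iff_vec_prod_zero[of _ m]) auto
    have rel: "(\<Sum>b<m. u $ b * N b i) = 0" if "i < m" for i
    proof -
      have "(W\<^sup>T *\<^sub>v u) $ i = 0" using u(3) that by simp
      then show ?thesis using that u(1) by (simp add: W_def scalar_prod_def atLeast0LessThan mult.commute)
    qed
    obtain j where j: "j < m" "u $ j \<noteq> 0"
      using u(1,2) by (metis carrier_vecD eq_vecI index_zero_vec(1) index_zero_vec(2))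
    \<comment> \<open>Subtracting this multiple of the relation removes row \<open>j\<close> without
      changing \<open>y\<close> in the columns \<open>0\<close> to \<open>p\<close>. The relation is
      known in no further column, but the induction hypothesis asks for no other.\<close>
    define s where "s = x j / u $ j"
    define skip where "skip b = (if b < j then b else Suc b)" for b
    define x' where "x' b = x (skip b) - s * u $ (skip b)" for b
    have "totally_nonneg (\<lambda>b i. N (skip b) i)"
      using totally_nonneg_reindex[OF Suc.prems, of skip "\<lambda>i. i"] 
      by (auto simp: strict_mono_def skip_def)
    from Suc.IH[OF this, of x'] obtain i where i: "i \<le> p"
      "\<not> (-1) ^ i * (\<Sum>b<p. x' b * N (skip b) i) > 0" by auto
    have "y i = (\<Sum>b<m. (x b - s * u $ b) * N b i)"
      using rel[of i] i by (simp add: y_def m_def algebra_simps sum_subtractf sum_distrib_left[symmetric] del: sum.lessThan_Suc)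
    also have "\<dots> = (\<Sum>b\<in>{..<m}-{j}. (x b - s * u $ b) * N b i)"
      using j by (subst sum.remove[of _ j]) (auto simp: s_def)
    also have "\<dots> = (\<Sum>b<p. x' b * N (skip b) i)"
    proof (rule sum.reindex_bij_betw[symmetric, where h = skip, of "{..<p}" "{..<m}-{j}" "\<lambda>b. (x b - s * u $ b) * N b i", folded x'_def])
      show "bij_betw skip {..<p} ({..<m} - {j})"
        by (rule bij_betwI[where g = "\<lambda>b. if b < j then b else b - 1"]) (use j in \<open>auto simp: skip_def m_def split: if_splits\<close>)
    qed
    finally have "y i = (\<Sum>b<p. x' b * N (skip b) i)" .
    then show False using alt[rule_format, of i] i by (simp add: y_def[symmetric] del: sum.lessThan_Suc)
  qed
qed

section \<open>Totally nonnegative Toeplitz matrices of polynomials\<close>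

definition toeplitz :: "real poly \<Rightarrow> nat \<Rightarrow> nat \<Rightarrow> real" where
  "toeplitz A r c = (if r \<le> c then coeff A (c - r) else 0)"

lemma totally_nonneg_entry:
  assumes "totally_nonneg M"
  shows "M i j \<ge> 0"
proof -
  have "minor_det M 1 (\<lambda>_. i) (\<lambda>_. j) \<ge> 0"
    using assms by (intro totally_nonnegD) (auto simp: strict_mono_on_def)
  then show ?thesis by (simp add: minor_det_def Determinant.det_single)
qed

lemma poly_of_real_cnj:
  "poly (map_poly complex_of_real A) (cnj z) = cnj (poly (map_poly complex_of_real A) z)"
  by (induction A) (auto simp: map_poly_pCons)

lemma poly_of_real_of_real:
  "poly (map_poly complex_of_real A) (complex_of_real x) = complex_of_real (poly A x)"
  by (induction A) (auto simp: map_poly_pCons)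

lemma toeplitz_sum:
  assumes "degree A \<le> r" "r < L"
  shows "(\<Sum>j<L. c j * toeplitz A j r) = (\<Sum>k\<le>degree A. coeff A k * c (r - k))"
proof -
  have "(\<Sum>j<L. c j * toeplitz A j r) = (\<Sum>j\<in>{r - degree A..r}. c j * toeplitz A j r)"
    using assms by (intro sum.mono_neutral_right) (auto simp: toeplitz_def coeff_eq_0)
  also have "\<dots> = (\<Sum>k\<le>degree A. coeff A k * c (r - k))"
    using assms by (intro sum.reindex_bij_witness[of _ "\<lambda>k. r - k" "\<lambda>j. r - j"]) (auto simp: toeplitz_def)
  finally show ?thesis .
qed

lemma sum_coeff_mult_power_diff:
  fixes z :: "'a :: field"
  assumes "degree P \<le> r" "z \<noteq> 0"
  shows "(\<Sum>k\<le>degree P. coeff P k * z ^ (r - k)) = z ^ r * poly P (1 / z)"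
  unfolding poly_altdef sum_distrib_left
  using assms by (intro sum.cong) (auto simp: power_diff field_simps power_one_over)

text \<open>Each \<open>j\<close> forbids only countably many phases. A sequence without zero terms
  keeps its signs under a small perturbation.\<close>

lemma exists_phase:
  fixes \<theta> :: real
  shows "\<exists>\<alpha>. 0 < \<alpha> \<and> \<alpha> < pi \<and> (\<forall>j::nat. sin (real j * \<theta> + \<alpha>) \<noteq> 0)"
proof -
  define B where "B = (\<Union>j::nat. range (\<lambda>m::int. of_int m * pi - real j * \<theta>))"
  have "countable B" unfolding B_def by auto
  moreover have "uncountable {0<..<pi}" by (simp add: uncountable_open_interval)
  ultimately have "\<not> {0<..<pi} \<subseteq> B" using countable_subset by blast
  then obtain \<alpha> where \<alpha>: "0 < \<alpha>" "\<alpha> < pi" "\<alpha> \<notin> B"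
    unfolding subset_iff by (metis greaterThanLessThan_iff)
  have "sin (real j * \<theta> + \<alpha>) \<noteq> 0" for j :: nat
  proof
    assume "sin (real j * \<theta> + \<alpha>) = 0"
    then obtain m :: int where "real j * \<theta> + \<alpha> = of_int m * pi" by (auto simp: sin_zero_iff_int2)
    then have "\<alpha> = of_int m * pi - real j * \<theta>" by simp
    with \<alpha>(3) show False unfolding B_def by blast
  qed
  with \<alpha> show ?thesis by blast
qed

lemma exists_sgn_preserving_perturbation:
  fixes e d :: "nat \<Rightarrow> real"
  assumes "\<And>j. e j \<noteq> 0"
  shows "\<exists>\<epsilon>>0. \<forall>j<L. sgn (e j + \<epsilon> * d j) = sgn (e j)"
proof -
  have "eventually (\<lambda>\<epsilon>. sgn (e j + \<epsilon> * d j) = sgn (e j)) (at_right 0)" for j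
  proof -
    have lim: "((\<lambda>\<epsilon>. e j + \<epsilon> * d j) \<longlongrightarrow> e j) (at_right 0)"
      by (auto intro!: tendsto_eq_intros)
    show ?thesis
    proof (cases "e j > 0")
      case True
      from order_tendstoD(1)[OF lim this] show ?thesis by eventually_elim (use True in auto)
    next
      case False
      with assms[of j] have "e j < 0" by (meson linorder_neqE_linordered_idom)
      from order_tendstoD(2)[OF lim this] show ?thesis
        by eventually_elim (use \<open>e j < 0\<close> in auto)
    qed
  qed
  then have "eventually (\<lambda>\<epsilon>. \<forall>j\<in>{..<L}. sgn (e j + \<epsilon> * d j) = sgn (e j)) (at_right 0)"
    by (intro eventually_ball_finite) auto
  moreover have "eventually (\<lambda>\<epsilon>. \<epsilon> > (0::real)) (at_right 0)"
    by (rule eventually_at_right_less)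
  ultimately have "eventually (\<lambda>\<epsilon>. \<epsilon> > 0 \<and> (\<forall>j\<in>{..<L}. sgn (e j + \<epsilon> * d j) = sgn (e j))) (at_right 0)"
    by eventually_elim auto
  from eventually_happens'[OF _ this] show ?thesis by auto
qed

lemma sgn_sin_eq_floor:
  assumes "u > 0" "sin u \<noteq> 0"
  shows "sgn (sin u) = (-1) ^ nat \<lfloor>u / pi\<rfloor>"
proof -
  define m where "m = nat \<lfloor>u / pi\<rfloor>"
  have "u / pi \<ge> 0" using assms by simp
  then have "real m = of_int \<lfloor>u / pi\<rfloor>" by (simp add: m_def)
  then have "real m \<le> u / pi" "u / pi < real m + 1" by linarith+
  then have v: "u - real m * pi \<ge> 0" "u - real m * pi < pi" by (auto simp: field_simps)
  have s: "sin u = (-1) ^ m * sin (u - real m * pi)"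
    using sin_add[of "u - real m * pi" "real m * pi"] by (simp add: cos_npi mult_ac)
  moreover have "sin (u - real m * pi) \<ge> 0" using v by (intro sin_ge_zero) auto
  moreover have "sin (u - real m * pi) \<noteq> 0" using assms s by auto
  ultimately show ?thesis by (simp add: sgn_mult m_def[symmetric])
qed

text \<open>
  For a nonreal zero \<open>t\<close>, the sequence \<open>Im (cis \<alpha> * (1 / t) ^ j)\<close> is annihilated by
  \<open>A\<close> and changes sign less than once per step. A tiny multiple of a geometric progression with
  negative ratio does not affect its signs but dictates those of the image, which then
  alternates at every step.
\<close>

lemma totally_nonneg_toeplitz_no_lower_zero:
  assumes T: "totally_nonneg (toeplitz A)" and A0: "A \<noteq> 0" and t: "Im t < 0"
  shows "poly (map_poly complex_of_real A) t \<noteq> 0"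
proof
  assume root: "poly (map_poly complex_of_real A) t = 0"
  define n where "n = degree A"
  have t0: "t \<noteq> 0" using t by auto
  define z where "z = 1 / t"
  define s where "s = cmod z"
  define \<theta> where "\<theta> = Arg z"
  have z0: "z \<noteq> 0" using t0 by (simp add: z_def)
  have "Im z > 0" using t by (simp add: z_def Im_divide divide_neg_pos t0 sum_power2_gt_zero_iff complex_eq_iff)
  then have \<theta>: "0 < \<theta>" "\<theta> < pi" unfolding \<theta>_def using Arg_lt_pi z0 by auto
  have z_eq: "z = of_real s * cis \<theta>" unfolding s_def \<theta>_def using Arg_eq[OF z0] by (simp add: cis_conv_exp)
  have s0: "s > 0" using z0 by (simp add: s_def)
  \<comment> \<open>The ratio \<open>1 / x\<close> has to be negative, and \<open>A\<close> must not
    vanish at \<open>x\<close>, so that the perturbation survives in the image.\<close>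
  have "infinite ({..<0} - {x. poly A x = 0})"
    using poly_roots_finite[OF A0] infinite_Iio[of "0::real"] by (intro Diff_infinite_finite) auto
  then have "({..<0} - {x. poly A x = 0}) \<noteq> {}" by (metis finite.emptyI)
  then obtain x where x: "x < 0" "poly A x \<noteq> 0" by auto
  obtain \<alpha> where \<alpha>: "0 < \<alpha>" "\<alpha> < pi" "\<And>j::nat. sin (real j * \<theta> + \<alpha>) \<noteq> 0"
    using exists_phase[of \<theta>] by blast
  \<comment> \<open>The first \<open>L\<close> terms form about \<open>L * \<theta> / pi\<close>
    sign blocks, and \<open>\<theta> < pi\<close>. The bound leaves room for \<open>p + 1\<close>
    columns after the first \<open>n\<close>.\<close>
  obtain L :: nat where L: "real L > (real n + 3) / (1 - \<theta> / pi)" using reals_Archimedean2 by blast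
  define e where "e j = Im (cis \<alpha> * z ^ j)" for j
  define d where "d j = (1 / x) ^ j" for j
  have e_eq: "e j = s ^ j * sin (real j * \<theta> + \<alpha>)" for j
  proof -
    have "cis \<alpha> * z ^ j = of_real (s ^ j) * cis (real j * \<theta> + \<alpha>)"
      unfolding z_eq power_mult_distrib Complex.DeMoivre of_real_power
      by (simp only: mult.left_commute[of "cis \<alpha>"] cis_mult add.commute[of \<alpha>])
    then show ?thesis by (simp add: e_def)
  qed
  obtain \<epsilon> where \<epsilon>: "\<epsilon> > 0" "\<And>j. j < L \<Longrightarrow> sgn (e j + \<epsilon> * d j) = sgn (e j)"
    using exists_sgn_preserving_perturbation[of e L d] \<alpha>(3) s0 by (auto simp: e_eq)
  define c where "c j = e j + \<epsilon> * d j" for j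
  define blk where "blk j = nat \<lfloor>(real j * \<theta> + \<alpha>) / pi\<rfloor>" for j :: nat
  have c_sgn: "c j = (-1) ^ blk j * \<bar>c j\<bar>" if "j < L" for j
  proof -
    have "sgn (c j) = (-1) ^ blk j"
      using \<epsilon>(2)[OF that] s0 \<alpha> \<theta> by (simp add: c_def e_eq sgn_mult blk_def sgn_sin_eq_floor add_nonneg_pos)
    then show ?thesis by (metis mult_sgn_abs)
  qed
  have blk_mono: "blk i \<le> blk j" if "i \<le> j" for i j
    unfolding blk_def using that \<theta> by (intro nat_mono floor_mono divide_right_mono add_right_mono mult_right_mono) auto
  \<comment> \<open>Terms of one sign block are merged into one row with nonnegative weights, so the
    image of \<open>c\<close> combines only \<open>p\<close> rows of a totally nonnegative
    matrix.\<close>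
  define S where "S b = {j. j < L \<and> blk j = b}" for b
  define N where "N b r = (\<Sum>j\<in>S b. \<bar>c j\<bar> * toeplitz A j r)" for b r
  have N: "totally_nonneg N"
    unfolding N_def
  proof (rule totally_nonneg_merge_rows[OF T, where w = "\<lambda>_ j. \<bar>c j\<bar>"])
    show "j \<le> j'" if "b < b'" "j \<in> S b" "j' \<in> S b'" for b b' j j'
      using that blk_mono[of j' j] by (cases "j \<le> j'") (auto simp: S_def)
  qed (auto simp: S_def)
  define p where "p = blk L + 1"
  have pL: "n + p < L"
  proof -
    have "1 - \<theta> / pi > 0" using \<theta> by simp
    then have "real L * (1 - \<theta> / pi) > real n + 3" using L by (simp add: pos_divide_less_eq)
    moreover have "real (blk L) \<le> (real L * \<theta> + \<alpha>) / pi"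
      using \<theta> \<alpha> by (auto simp: blk_def)
    moreover have "(real L * \<theta> + \<alpha>) / pi \<le> real L * (\<theta> / pi) + 1" using \<alpha> by (simp add: add_divide_distrib)
    ultimately have "real n + real p < real L" by (simp add: p_def algebra_simps)
    then show ?thesis by linarith
  qed
  have y: "(\<Sum>b<p. (-1) ^ b * N b r) = \<epsilon> * ((1 / x) ^ r * poly A x)" if r: "n \<le> r" "r < L" for r
  proof -
    have "(\<Sum>b<p. (-1) ^ b * N b r) = (\<Sum>b<p. \<Sum>j\<in>{j\<in>{..<L}. blk j = b}. c j * toeplitz A j r)"
      unfolding N_def S_def sum_distrib_left
    proof (intro sum.cong refl)
      fix b j assume "j \<in> {j \<in> {..<L}. blk j = b}"
      then show "(-1) ^ b * (\<bar>c j\<bar> * toeplitz A j r) = c j * toeplitz A j r"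
        using c_sgn[of j] by auto
    qed auto
    also have "\<dots> = (\<Sum>j<L. c j * toeplitz A j r)"
      using blk_mono by (intro sum.group) (auto simp: p_def less_Suc_eq_le)
    also have "\<dots> = (\<Sum>k\<le>n. coeff A k * c (r - k))"
      using r unfolding n_def by (intro toeplitz_sum)
    also have "\<dots> = (\<Sum>k\<le>n. coeff A k * e (r - k)) + \<epsilon> * (\<Sum>k\<le>n. coeff A k * d (r - k))"
      by (simp add: c_def algebra_simps sum.distrib sum_distrib_left)
    also have "(\<Sum>k\<le>n. coeff A k * d (r - k)) = (1 / x) ^ r * poly A x"
      unfolding d_def n_def using x r by (subst sum_coeff_mult_power_diff) (auto simp: n_def)
    also have "(\<Sum>k\<le>n. coeff A k * e (r - k)) = Im (cis \<alpha> * (\<Sum>k\<le>n. of_real (coeff A k) * z ^ (r - k)))"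
      unfolding e_def sum_distrib_left Im_sum by (intro sum.cong) (auto simp: algebra_simps)
    also have "(\<Sum>k\<le>n. of_real (coeff A k) * z ^ (r - k)) = z ^ r * poly (map_poly of_real A) (1 / z)"
      using sum_coeff_mult_power_diff[of "map_poly of_real A" r z] z0 r
      by (simp add: n_def coeff_map_poly degree_map_poly)
    also have "\<dots> = 0" using root by (simp add: z_def)
    finally show ?thesis by simp
  qed
  define \<sigma> where "\<sigma> = sgn ((1 / x) ^ n * poly A x)"
  have "\<forall>i\<le>p. (-1) ^ i * (\<Sum>b<p. (\<sigma> * (-1) ^ b) * N b (n + i)) > 0"
  proof (intro allI impI)
    fix i assume i: "i \<le> p"
    have "(-1) ^ i * (\<Sum>b<p. (\<sigma> * (-1) ^ b) * N b (n + i)) =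
        (-1) ^ i * \<sigma> * (\<Sum>b<p. (-1) ^ b * N b (n + i))"
      by (simp add: sum_distrib_left mult_ac)
    also have "\<dots> = \<epsilon> * ((-1) ^ i * (1 / x) ^ i) * (\<sigma> * ((1 / x) ^ n * poly A x))"
      using y[of "n + i"] i pL by (simp add: power_add)
    also have "(-1) ^ i * (1 / x) ^ i = (1 / - x) ^ i" by (simp flip: power_mult_distrib)
    also have "\<sigma> * ((1 / x) ^ n * poly A x) = \<bar>(1 / x) ^ n * poly A x\<bar>"
      unfolding \<sigma>_def by (simp add: abs_sgn mult.commute)
    also have "\<epsilon> * (1 / - x) ^ i * \<bar>(1 / x) ^ n * poly A x\<bar> > 0"
      using \<epsilon> x by (intro mult_pos_pos zero_less_power) auto
    finally show "(-1) ^ i * (\<Sum>b<p. (\<sigma> * (-1) ^ b) * N b (n + i)) > 0" .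
  qed
  moreover have "totally_nonneg (\<lambda>b i. N b (n + i))"
    using totally_nonneg_reindex[OF N, of "\<lambda>b. b" "\<lambda>i. n + i"] by (simp add: strict_mono_def)
  ultimately show False
    using totally_nonneg_no_alternation[of "\<lambda>b i. N b (n + i)" p "\<lambda>b. \<sigma> * (-1) ^ b"] by blast
qed

text \<open>Conjugation moves a nonreal zero into the lower half-plane; positive zeros are
  impossible because the coefficients are entries of the matrix.\<close>

lemma totally_nonneg_toeplitz_imp_only_nonpos_zeros:
  assumes T: "totally_nonneg (toeplitz A)" and A0: "A \<noteq> 0"
  shows "only_nonpos_zeros A"
  unfolding only_nonpos_zeros_def
proof (intro allI impI)
  fix t :: complex assume root: "poly (map_poly of_real A) t = 0"
  have "Im t = 0"
  proof (rule ccontr)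
    assume "Im t \<noteq> 0"
    then have "Im t < 0 \<or> Im (cnj t) < 0" by auto
    then show False
      using totally_nonneg_toeplitz_no_lower_zero[OF T A0] root by (metis complex_cnj_zero poly_of_real_cnj)
  qed
  then have t: "t = of_real (Re t)" by (simp add: complex_eq_iff)
  then have "poly A (Re t) = 0" using root by (metis of_real_eq_0_iff poly_of_real_of_real)
  moreover have "poly A x > 0" if "x > 0" for x
  proof -
    have nn: "coeff A i \<ge> 0" for i using totally_nonneg_entry[OF T, of 0 i] by (simp add: toeplitz_def)
    have "0 < lead_coeff A * x ^ degree A" using nn[of "degree A"] A0 that
      by (intro mult_pos_pos order.not_eq_order_implies_strict) auto
    also have "\<dots> \<le> poly A x" unfolding poly_altdef
      using nn that by (intro member_le_sum[of "degree A" _ "\<lambda>i. coeff A i * x ^ i"]) auto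
    finally show ?thesis .
  qed
  ultimately have "Re t \<le> 0" by (cases "Re t > 0") fastforce+
  then show "t \<in> \<real> \<and> Re t \<le> 0" using complex_is_Real_iff \<open>Im t = 0\<close> by simp
qed

section \<open>Matrices of Stieltjes continued fractions\<close>

text \<open>In the variable \<open>t\<close> the rows are \<open>F, G, t F, t G, ...\<close>. Both
  cases of the Hurwitz type matrix have this form, with \<open>G\<close> divisible by
  \<open>t\<close>.\<close>

definition shift_matrix :: "real poly \<Rightarrow> real poly \<Rightarrow> nat \<Rightarrow> nat \<Rightarrow> real" where
  "shift_matrix F G r c =
     (if r div 2 \<le> c then coeff (if even r then F else G) (c - r div 2) else 0)"

text \<open>
  \<open>sfrac D P Q\<close>: one has \<open>P = D * P'\<close>, \<open>Q = D * Q'\<close>, where \<open>Q' / P'\<close> is the Stieltjes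
  continued fraction \<open>1 / (c\<^sub>0 + t / (c\<^sub>1 + t / (c\<^sub>2 + \<dots>)))\<close> with positive \<open>c\<^sub>i\<close>.
\<close>

inductive sfrac :: "real poly \<Rightarrow> real poly \<Rightarrow> real poly \<Rightarrow> bool" for D where
  sfrac_base: "sfrac D D 0"
| sfrac_step: "sfrac D P Q \<Longrightarrow> c > 0 \<Longrightarrow> sfrac D (Polynomial.smult c P + pCons 0 Q) P"

lemma sfrac_dvd: "sfrac D P Q \<Longrightarrow> D dvd P \<and> D dvd Q"
proof (induction rule: sfrac.induct)
  case (sfrac_step P Q c)
  moreover have "pCons 0 Q = [:0, 1:] * Q" by simp
  ultimately show ?case by (metis dvd_add dvd_mult dvd_smult)
qed simp

lemma sfrac_coeff_0_pos: "sfrac D P Q \<Longrightarrow> coeff P 0 > 0 \<Longrightarrow> coeff D 0 > 0"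
  by (induction rule: sfrac.induct) (auto simp: zero_less_mult_iff)

lemma coeff_pCons_diff: "coeff (pCons a P) (k - m) = (if k \<le> m then a else coeff P (k - Suc m))"
proof (cases "k \<le> m")
  case False
  then have "k - m = Suc (k - Suc m)" by simp
  then show ?thesis using False by simp
qed simp

lemma totally_nonneg_shift_matrix_base:
  assumes "totally_nonneg (toeplitz D)"
  shows "totally_nonneg (shift_matrix D 0)"
proof -
  have "totally_nonneg (\<lambda>r c. \<Sum>s\<in>(if even r then {r div 2} else {}). 1 * toeplitz D s c)"
    by (rule totally_nonneg_merge_rows[OF assms, where w = "\<lambda>_ _. 1"]) (auto split: if_splits)
  also have "(\<lambda>r c. \<Sum>s\<in>(if even r then {r div 2} else {}). 1 * toeplitz D s c) = shift_matrix D 0"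
    by (auto simp: fun_eq_iff shift_matrix_def toeplitz_def)
  finally show ?thesis .
qed

text \<open>The old rows run \<open>P, t Q, t P, ...\<close>. The new row \<open>2 * j\<close> is
  \<open>c\<close> times the old one plus its successor, and the new row \<open>2 * j + 1\<close> is
  the old row \<open>2 * j + 2\<close>: a nonnegative bidiagonal factor.\<close>

lemma totally_nonneg_shift_matrix_step:
  assumes "totally_nonneg (shift_matrix P (pCons 0 Q))" "c \<ge> 0"
  shows "totally_nonneg (shift_matrix (Polynomial.smult c P + pCons 0 Q) (pCons 0 P))"
proof -
  define S where "S r = (if even r then {r, Suc r} else {Suc r})" for r :: nat
  define w where "w r s = (if even r \<and> s = r then c else 1)" for r s :: nat
  have "totally_nonneg (\<lambda>r k. \<Sum>s\<in>S r. w r s * shift_matrix P (pCons 0 Q) s k)"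
  proof (rule totally_nonneg_merge_rows[OF assms(1)])
    show "s \<le> s'" if "r < r'" "s \<in> S r" "s' \<in> S r'" for r r' s s'
      using that by (cases "r' = Suc r") (auto simp: S_def split: if_splits)
  qed (use assms(2) in \<open>auto simp: S_def w_def\<close>)
  also have "(\<lambda>r k. \<Sum>s\<in>S r. w r s * shift_matrix P (pCons 0 Q) s k) =
      shift_matrix (Polynomial.smult c P + pCons 0 Q) (pCons 0 P)"
  proof (intro ext)
    fix r k
    show "(\<Sum>s\<in>S r. w r s * shift_matrix P (pCons 0 Q) s k) =
      shift_matrix (Polynomial.smult c P + pCons 0 Q) (pCons 0 P) r k"
    proof (cases "even r")
      case True
      then show ?thesis by (simp add: S_def w_def shift_matrix_def)
    next
      case False
      then have "Suc r div 2 = Suc (r div 2)" by presburger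
      then show ?thesis using False
        by (auto simp: S_def w_def shift_matrix_def coeff_pCons_diff)
    qed
  qed
  finally show ?thesis .
qed

lemma sfrac_imp_totally_nonneg:
  "sfrac D P Q \<Longrightarrow> totally_nonneg (toeplitz D) \<Longrightarrow> totally_nonneg (shift_matrix P (pCons 0 Q))"
proof (induction rule: sfrac.induct)
  case sfrac_base
  then show ?case using totally_nonneg_shift_matrix_base by simp
next
  case (sfrac_step P Q c)
  then show ?case using totally_nonneg_shift_matrix_step[of P Q c] by simp
qed

section \<open>Toeplitz matrices of polynomials with only nonpositive zeros\<close>

lemma totally_nonneg_toeplitz_const:
  assumes "\<kappa> \<ge> 0"
  shows "totally_nonneg (toeplitz [:\<kappa>:])"
  unfolding totally_nonneg_alt
proof (intro allI impI)
  fix k and r c :: "nat \<Rightarrow> nat"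
  assume r: "strict_mono_on {..<k} r" and c: "strict_mono_on {..<k} c"
  have T: "toeplitz [:\<kappa>:] i j = (if i = j then \<kappa> else 0)" for i j
    by (auto simp: toeplitz_def coeff_pCons split: nat.splits)
  show "minor_det (toeplitz [:\<kappa>:]) k r c \<ge> 0"
  proof (cases "\<forall>i<k. r i = c i")
    case True
    have inj: "c i = c j \<longleftrightarrow> i = j" if "i < k" "j < k" for i j
      using that strict_mono_on_imp_inj_on[OF c] by (auto simp: inj_on_def)
    have "Matrix.mat k k (\<lambda>(i, j). toeplitz [:\<kappa>:] (r i) (c j)) = \<kappa> \<cdot>\<^sub>m 1\<^sub>m k"
      using True inj by (intro eq_matI) (auto simp: T)
    then show ?thesis using assms by (simp add: minor_det_def)
  next
    case False
    \<comment> \<open>At the first mismatch the smaller of \<open>r i\<close> and \<open>c i\<close>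
      does not occur in the other selection, so the minor has a zero row or a zero column.\<close>
    then obtain i where i: "i < k" "r i \<noteq> c i" "\<And>j. j < i \<Longrightarrow> r j = c j"
      using exists_least_iff[of "\<lambda>i. i < k \<and> r i \<noteq> c i"] by (meson order.strict_trans)
    have rs: "r a < r b" if "a < b" "b < k" for a b using r that by (auto simp: strict_mono_on_def)
    have cs: "c a < c b" if "a < b" "b < k" for a b using c that by (auto simp: strict_mono_on_def)
    let ?M = "Matrix.mat k k (\<lambda>(i, j). toeplitz [:\<kappa>:] (r i) (c j))"
    have M: "?M \<in> carrier_mat k k" by simp
    have "Determinant.det ?M = 0"
    proof (cases "r i < c i")
      case True
      have "r i \<noteq> c j" if "j < k" for j
      proof (cases "j < i")
        case False
        then have "c i \<le> c j" using cs[of i j] that by (cases "i = j") auto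
        then show ?thesis using True by simp
      next
        case True
        then show ?thesis using i rs[of j i] by force
      qed
      then show ?thesis
        using i by (subst Determinant.laplace_expansion_row[OF M, of i]) (auto simp: T intro!: sum.neutral)
    next
      case False
      then have lt: "c i < r i" using i by simp
      have "r j \<noteq> c i" if "j < k" for j
      proof (cases "j < i")
        case False
        then have "r i \<le> r j" using rs[of i j] that by (cases "i = j") auto
        then show ?thesis using lt by simp
      next
        case True
        then show ?thesis using i cs[of j i] by force
      qed
      then show ?thesis
        using i by (subst Determinant.laplace_expansion_column[OF M, of i]) (auto simp: T intro!: sum.neutral)
    qed
    then show ?thesis by (simp add: minor_det_def)
  qed
qed

text \<open>Row \<open>Suc r\<close> is \<open>t\<close> times row \<open>r\<close>, so the factor
  \<open>1 + \<beta> t\<close> adds \<open>\<beta>\<close> times the next row to each row.\<close>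

lemma totally_nonneg_toeplitz_linear_factor:
  assumes "totally_nonneg (toeplitz A)" "\<beta> \<ge> 0"
  shows "totally_nonneg (toeplitz ([:1, \<beta>:] * A))"
proof -
  define w where "w r s = (if s = r then 1 else \<beta>)" for r s :: nat
  have "totally_nonneg (\<lambda>r k. \<Sum>s\<in>{r, Suc r}. w r s * toeplitz A s k)"
    by (rule totally_nonneg_merge_rows[OF assms(1)]) (use assms(2) in \<open>auto simp: w_def\<close>)
  also have "(\<lambda>r k. \<Sum>s\<in>{r, Suc r}. w r s * toeplitz A s k) = toeplitz ([:1, \<beta>:] * A)"
    by (auto simp: fun_eq_iff w_def toeplitz_def coeff_pCons_diff)
  finally show ?thesis .
qed

lemma only_nonpos_zeros_imp_totally_nonneg_toeplitz:
  assumes "only_nonpos_zeros A" "coeff A 0 > 0"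
  shows "totally_nonneg (toeplitz A)"
  using assms
proof (induction "degree A" arbitrary: A)
  case 0
  from 0(1)[symmetric] obtain \<kappa> where "A = [:\<kappa>:]" by (rule degree_eq_zeroE)
  then show ?case using 0(3) by (simp add: totally_nonneg_toeplitz_const)
next
  case (Suc n)
  have "degree (map_poly complex_of_real A) \<noteq> 0" using Suc.hyps(2)[symmetric] by (simp add: degree_map_poly)
  then have nc: "\<not> constant (poly (map_poly complex_of_real A))" by (simp add: constant_degree)
  from Fundamental_Theorem_Algebra.fundamental_theorem_of_algebra[OF nc]
  obtain z where z: "poly (map_poly of_real A) z = (0::complex)" ..
  then have "z \<in> \<real>" "Re z \<le> 0" using Suc.prems(1) unfolding only_nonpos_zeros_def by blast+
  then obtain x where x: "z = of_real x" "x \<le> 0" by (auto elim: Reals_cases)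
  have root: "poly A x = 0" using z x by (metis of_real_eq_0_iff poly_of_real_of_real)
  then have "x \<noteq> 0" using Suc.prems by (auto simp: poly_0_coeff_0)
  then have x0: "x < 0" using x by simp
  obtain B where B: "A = [:- x, 1:] * B" using root by (auto simp: poly_eq_0_iff_dvd dvd_def)
  \<comment> \<open>The factor \<open>1 - t / x\<close> in place of \<open>t - x\<close> preserves
    the constant coefficient, and \<open>x < 0\<close> makes its other coefficient positive.\<close>
  define B' where "B' = Polynomial.smult (- x) B"
  have A: "A = [:1, - (1 / x):] * B'" proof -
    have "[:- x, 1:] = Polynomial.smult (- x) [:1, - (1 / x):]" using x0 by simp
    then show ?thesis unfolding B B'_def by (simp only: mult_smult_left mult_smult_right)
  qed
  have "B' \<noteq> 0" using A Suc.hyps by auto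
  then have "degree A = Suc (degree B')" unfolding A using x0 by (subst degree_mult_eq) auto
  moreover have "coeff B' 0 = coeff A 0" unfolding A by simp
  moreover have "only_nonpos_zeros B'"
  proof -
    have "poly (map_poly of_real A) w = 0" if "poly (map_poly of_real B') w = (0::complex)" for w
    proof -
      have "map_poly complex_of_real A = map_poly of_real [:1, - (1 / x):] * map_poly of_real B'"
        unfolding A by (rule poly_eqI) (simp only: coeff_map_poly of_real_0 coeff_mult of_real_sum of_real_mult)
      then show ?thesis using that by simp
    qed
    then show ?thesis using Suc.prems by (auto simp: only_nonpos_zeros_def)
  qed
  ultimately have "totally_nonneg (toeplitz B')" using Suc by auto
  then show ?case unfolding A using x0 by (intro totally_nonneg_toeplitz_linear_factor) auto
qed

text \<open>The last column is free because of what these minors compute for the matrix of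
  \<open>(P, t Q)\<close>: as long as the divisions producing \<open>P, Q, S, ...\<close> can be
  carried out, \<open>c = k + i\<close> gives coefficient \<open>i\<close> of the
  \<open>k\<close>-th polynomial (counted from \<open>0\<close>) times the constant coefficients of
  the earlier ones.\<close>

definition initial_minor :: "(nat \<Rightarrow> nat \<Rightarrow> real) \<Rightarrow> nat \<Rightarrow> nat \<Rightarrow> real" where
  "initial_minor M k c = minor_det M (Suc k) (\<lambda>i. i) (\<lambda>j. if j = k then c else j)"

lemma totally_nonneg_imp_initial_minor:
  "totally_nonneg M \<Longrightarrow> k \<le> c \<Longrightarrow> initial_minor M k c \<ge> 0"
  unfolding initial_minor_def by (intro totally_nonnegD) (auto simp: strict_mono_on_def)

lemma initial_minor_Suc:
  assumes "\<And>i. i > 0 \<Longrightarrow> M i 0 = 0"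
  shows "initial_minor M (Suc k) (Suc c) = M 0 0 * initial_minor (\<lambda>i j. M (Suc i) (Suc j)) k c"
proof -
  define K where "K = Suc k"
  define Z where "Z = Matrix.mat (Suc K) (Suc K) (\<lambda>(i, j). M i (if j = K then Suc c else j))"
  have Z: "Z \<in> carrier_mat (Suc K) (Suc K)" by (simp add: Z_def)
  have "Determinant.det Z = (\<Sum>i<Suc K. Z $$ (i, 0) * cofactor Z i 0)"
    by (rule Determinant.laplace_expansion_column[OF Z]) simp
  also have "\<dots> = (\<Sum>i\<in>{0}. Z $$ (i, 0) * cofactor Z i 0)"
    by (intro sum.mono_neutral_right) (auto simp: Z_def assms K_def)
  also have "\<dots> = M 0 0 * Determinant.det (mat_delete Z 0 0)" by (simp add: cofactor_def Z_def K_def)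
  also have "mat_delete Z 0 0 = Matrix.mat K K (\<lambda>(i, j). M (Suc i) (Suc (if j = k then c else j)))"
    by (intro eq_matI) (auto simp: mat_delete_def Z_def K_def)
  finally show ?thesis
    by (simp add: initial_minor_def minor_det_def Z_def K_def)
qed

text \<open>
  Below its first row and to the right of its first column, the matrix of
  \<open>(\<gamma> Q + t S, t Q)\<close> is the matrix of \<open>(Q, t S)\<close> multiplied by a unitriangular matrix.
\<close>

lemma initial_minor_shift_matrix_step:
  assumes P: "P = Polynomial.smult \<gamma> Q + pCons 0 S"
  shows "initial_minor (shift_matrix P (pCons 0 Q)) (Suc k) (Suc c) =
    coeff P 0 * initial_minor (shift_matrix Q (pCons 0 S)) k c"
proof -
  define M where "M = shift_matrix P (pCons 0 Q)"
  define M' where "M' = shift_matrix Q (pCons 0 S)"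
  define K where "K = Suc k"
  define col where "col j = (if j = k then c else j)" for j
  have z0: "M i 0 = (if i = 0 then coeff P 0 else 0)" for i
    by (cases "i = 1") (auto simp: M_def shift_matrix_def)
  define Lm where "Lm = Matrix.mat K K (\<lambda>(i, j). if i = j then 1 else if odd i \<and> i = Suc j then \<gamma> else 0)"
  define N where "N = Matrix.mat K K (\<lambda>(i, j). M' i (col j))"
  have Lm: "Lm \<in> carrier_mat K K" and N: "N \<in> carrier_mat K K" by (auto simp: Lm_def N_def)
  have rel: "M (Suc i) (Suc j) = M' i j + (if odd i then \<gamma> * M' (i - 1) j else 0)" for i j
  proof (cases "odd i")
    case False
    then show ?thesis by (auto simp: M_def M'_def shift_matrix_def coeff_pCons Suc_diff_le split: nat.splits)
  next
    case True
    then have "Suc i div 2 = Suc (i div 2)" "(i - 1) div 2 = i div 2" "even (i - 1)" by presburger+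
    then show ?thesis using True P
      by (auto simp: M_def M'_def shift_matrix_def coeff_pCons split: nat.splits)
  qed
  have "Matrix.mat K K (\<lambda>(i, j). M (Suc i) (Suc (col j))) = Lm * N"
  proof (rule eq_matI)
    fix i j assume "i < dim_row (Lm * N)" "j < dim_col (Lm * N)"
    then have ij: "i < K" "j < K" by (auto simp: Lm_def N_def)
    have "(Lm * N) $$ (i, j) = (\<Sum>l\<in>{0..<K}. (if i = l then 1 else if odd i \<and> i = Suc l then \<gamma> else 0) * M' l (col j))"
      using ij by (simp add: Lm_def N_def scalar_prod_def)
    also have "\<dots> = (\<Sum>l\<in>{i} \<union> (if odd i then {i - 1} else {}). (if i = l then 1 else if odd i \<and> i = Suc l then \<gamma> else 0) * M' l (col j))"
      using ij by (intro sum.mono_neutral_right) (auto split: if_splits)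
    also have "\<dots> = M' i (col j) + (if odd i then \<gamma> * M' (i - 1) (col j) else 0)"
      by (auto elim!: oddE)
    finally show "Matrix.mat K K (\<lambda>(i, j). M (Suc i) (Suc (col j))) $$ (i, j) = (Lm * N) $$ (i, j)"
      using ij by (simp add: rel)
  qed (auto simp: Lm_def N_def)
  moreover have "Determinant.det Lm = 1"
  proof -
    have "Determinant.det Lm = prod_list (diag_mat Lm)"
      by (rule Determinant.det_lower_triangular[OF _ Lm]) (auto simp: Lm_def)
    also have "diag_mat Lm = map (\<lambda>_. 1) [0..<K]" by (auto simp: diag_mat_def Lm_def)
    also have "prod_list \<dots> = 1" by (simp add: map_replicate_const)
    finally show ?thesis .
  qed
  ultimately have "initial_minor (\<lambda>i j. M (Suc i) (Suc j)) k c = Determinant.det N"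
    using Determinant.det_mult[OF Lm N] by (simp add: initial_minor_def minor_det_def K_def col_def)
  moreover have "initial_minor M (Suc k) (Suc c) = M 0 0 * initial_minor (\<lambda>i j. M (Suc i) (Suc j)) k c"
    by (rule initial_minor_Suc) (simp add: z0)
  ultimately show ?thesis
    using z0[of 0] by (simp add: initial_minor_def minor_det_def M_def N_def M'_def K_def col_def)
qed

lemma initial_minor_1:
  "initial_minor M (Suc 0) c = M 0 0 * M (Suc 0) c - M 0 c * M (Suc 0) 0"
proof -
  define Z where "Z = Matrix.mat 2 2 (\<lambda>(i, j). M i (if j = 1 then c else j))"
  have Z: "Z \<in> carrier_mat 2 2" by (simp add: Z_def)
  have "Determinant.det Z = (\<Sum>i<2. Z $$ (i, 0) * cofactor Z i 0)"
    by (rule Determinant.laplace_expansion_column[OF Z]) simp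
  also have "\<dots> = M 0 0 * M (Suc 0) c - M 0 c * M (Suc 0) 0"
    by (simp add: numeral_2_eq_2 cofactor_def Determinant.det_single mat_delete_def Z_def)
  finally show ?thesis by (simp add: initial_minor_def minor_det_def Z_def numeral_2_eq_2)
qed

text \<open>The degree bounds for \<open>(P, Q)\<close> with \<open>m\<close> become those for
  \<open>(Q, S)\<close> with \<open>m - 1\<close>, so \<open>m\<close> bounds the number of
  divisions. Subtraction truncates at \<open>m = 0\<close>, hence the extra clause
  \<open>S = 0\<close>.\<close>

lemma euclid_step:
  fixes P Q :: "real poly"
  assumes "coeff Q 0 \<noteq> 0"
  obtains S where "P = Polynomial.smult (coeff P 0 / coeff Q 0) Q + pCons 0 S"
    "degree P \<le> (m + 1) div 2 \<Longrightarrow> degree Q \<le> m div 2 \<Longrightarrow> degree S \<le> (m - 1) div 2 \<and> (m = 0 \<longrightarrow> S = 0)"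
proof -
  define R where "R = P - Polynomial.smult (coeff P 0 / coeff Q 0) Q"
  have "coeff R 0 = 0" using assms by (simp add: R_def)
  then obtain S where S: "R = pCons 0 S" by (metis pCons_cases coeff_pCons_0)
  have "degree S \<le> (m - 1) div 2 \<and> (m = 0 \<longrightarrow> S = 0)"
    if "degree P \<le> (m + 1) div 2" "degree Q \<le> m div 2"
  proof -
    have "degree R \<le> (m + 1) div 2" unfolding R_def using that
      by (intro degree_diff_le) (auto intro!: order.trans[OF degree_smult_le] order.trans[OF that(2)])
    then show ?thesis unfolding S by (cases "S = 0") auto
  qed
  moreover have "P = Polynomial.smult (coeff P 0 / coeff Q 0) Q + pCons 0 S"
    using S by (simp add: R_def algebra_simps)
  ultimately show ?thesis using that by blast
qed

text \<open>Minors of order two show that \<open>Q\<close> has nonnegative coefficients. If its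
  constant coefficient is positive, a division passes the hypotheses on to \<open>(Q, S)\<close>; if
  it is zero, the fraction has to end.\<close>

lemma initial_minors_imp_sfrac:
  assumes "\<And>k c. k \<le> c \<Longrightarrow> initial_minor (shift_matrix P (pCons 0 Q)) k c \<ge> 0"
    and "coeff P 0 > 0" "degree P \<le> (m + 1) div 2" "degree Q \<le> m div 2"
  shows "\<exists>D. sfrac D P Q"
  using assms
proof (induction m arbitrary: P Q rule: less_induct)
  case (less m)
  define M where "M = shift_matrix P (pCons 0 Q)"
  define p0 where "p0 = coeff P 0"
  have M: "initial_minor M k c \<ge> 0" if "k \<le> c" for k c using less.prems(1) that by (simp add: M_def)
  have p0: "p0 > 0" using less.prems by (simp add: p0_def)
  have Qnn: "coeff Q i \<ge> 0" for i
  proof -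
    have "p0 * coeff Q i \<ge> 0"
      using M[of 1 "Suc i"] by (simp add: initial_minor_1 M_def shift_matrix_def p0_def)
    then show ?thesis using p0 by (simp add: zero_le_mult_iff)
  qed
  show ?case
  proof (cases "coeff Q 0 = 0")
    case True
    \<comment> \<open>With vanishing constant coefficient, \<open>t Q\<close> starts later than the
      row \<open>t P\<close> below it. The minors of order three then equal
      \<open>- (p0 * p0 * coeff Q i)\<close>, which forces \<open>Q = 0\<close>.\<close>
    have "coeff Q i = 0" for i
    proof (cases i)
      case (Suc j)
      have "initial_minor M 2 (Suc (Suc j)) = M 0 0 * initial_minor (\<lambda>i j. M (Suc i) (Suc j)) 1 (Suc j)"
        unfolding numeral_2_eq_2 One_nat_def
        by (rule initial_minor_Suc) (auto simp: M_def shift_matrix_def coeff_pCons)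
      also have "\<dots> = - (p0 * p0 * coeff Q i)"
        using True by (simp add: initial_minor_1 M_def shift_matrix_def p0_def Suc coeff_pCons)
      finally have "p0 * p0 * coeff Q i \<le> 0" using M[of 2 "Suc (Suc j)"] by simp
      then show ?thesis using p0 Qnn[of i] by (auto simp: mult_le_0_iff zero_less_mult_iff)
    qed (use True in simp)
    then have "Q = 0" by (simp add: poly_eq_iff)
    then show ?thesis using sfrac_base by blast
  next
    case False
    then have q0: "coeff Q 0 > 0" using Qnn[of 0] by simp
    from euclid_step[OF False, of P m]
    obtain S where S: "P = Polynomial.smult (coeff P 0 / coeff Q 0) Q + pCons 0 S"
      "degree S \<le> (m - 1) div 2" "m = 0 \<longrightarrow> S = 0" using less.prems by metis
    have "\<exists>D. sfrac D Q S"
    proof (cases "m = 0")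
      case True
      then show ?thesis using S(3) sfrac_base by blast
    next
      case False
      show ?thesis
      proof (rule less.IH[of "m - 1"])
        fix k c :: nat assume "k \<le> c"
        then have "coeff P 0 * initial_minor (shift_matrix Q (pCons 0 S)) k c \<ge> 0"
          using initial_minor_shift_matrix_step[OF S(1), of k c] less.prems(1)[of "Suc k" "Suc c"] by simp
        then show "initial_minor (shift_matrix Q (pCons 0 S)) k c \<ge> 0"
          using p0 by (simp add: p0_def zero_le_mult_iff)
      qed (use False less.prems S q0 in auto)
    qed
    then show ?thesis using sfrac_step[of _ Q S "coeff P 0 / coeff Q 0"] S(1) q0 p0
      by (metis divide_pos_pos p0_def)
  qed
qed

section \<open>Rational functions on the upper half-plane\<close>

abbreviation cpoly :: "real poly \<Rightarrow> complex \<Rightarrow> complex" where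
  "cpoly p \<equiv> poly (map_poly complex_of_real p)"

lemma cpoly_pCons [simp]: "cpoly (pCons a p) z = of_real a + z * cpoly p z"
  by (simp add: map_poly_pCons)

lemma cpoly_add [simp]: "cpoly (p + q) z = cpoly p z + cpoly q z"
proof -
  have "map_poly complex_of_real (p + q) = map_poly of_real p + map_poly of_real q"
    by (rule poly_eqI) (simp add: coeff_map_poly)
  then show ?thesis by simp
qed

lemma cpoly_smult [simp]: "cpoly (Polynomial.smult a p) z = of_real a * cpoly p z"
  by (induction p) (auto simp: algebra_simps)

lemma cpoly_mult [simp]: "cpoly (p * q) z = cpoly p z * cpoly q z"
  by (induction p) (auto simp: algebra_simps)

lemma cpoly_power [simp]: "cpoly (p ^ n) z = cpoly p z ^ n"
  by (induction n) (auto simp: one_pCons)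

lemma cpoly_diff [simp]: "cpoly (p - q) z = cpoly p z - cpoly q z"
proof -
  have "map_poly complex_of_real (p - q) = map_poly of_real p - map_poly of_real q"
    by (rule poly_eqI) (simp add: coeff_map_poly)
  then show ?thesis by simp
qed

lemma cpoly_minus [simp]: "cpoly (- p) z = - cpoly p z"
  using cpoly_diff[of 0 p z] by simp

lemma holomorphic_on_cpoly [holomorphic_intros]: "cpoly p holomorphic_on S"
  by (induction p) (auto intro!: holomorphic_intros simp del: holomorphic_on_ident)

lemma tendsto_cpoly [tendsto_intros]:
  "(f \<longlongrightarrow> l) F \<Longrightarrow> ((\<lambda>x. cpoly p (f x)) \<longlongrightarrow> cpoly p l) F"
  by (rule tendsto_compose[where g = "cpoly p"]) (auto intro: poly_isCont simp: isContD)

section \<open>Minimum principle and boundary behaviour\<close>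

lemma upper_half_plane: "open {z. Im z > 0}" "connected {z. Im z > 0}"
  by (auto intro: open_halfspace_Im_gt convex_connected convex_halfspace_Im_gt)

lemma Im_inverse_sign:
  fixes z :: complex
  shows "Im (inverse z) < 0 \<longleftrightarrow> Im z > 0" "Im (inverse z) > 0 \<longleftrightarrow> Im z < 0"
  by (auto simp: divide_less_0_iff zero_less_divide_iff not_less sum_power2_gt_zero_iff
      not_sum_power2_lt_zero)

lemma Im_divide_swap:
  fixes z w :: complex
  shows "Im (w / z) < 0 \<longleftrightarrow> Im (z / w) > 0" "Im (w / z) > 0 \<longleftrightarrow> Im (z / w) < 0"
  using Im_inverse_sign[of "z / w"] by simp_all

lemma constant_if_Im_attains_min:
  assumes hol: "f holomorphic_on {z. Im z > 0}" and z1: "Im z1 > 0"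
    and min: "\<And>z. Im z > 0 \<Longrightarrow> Im (f z1) \<le> Im (f z)"
  shows "f constant_on {z. Im z > 0}"
proof (rule ccontr)
  assume "\<not> f constant_on {z. Im z > 0}"
  then have "open (f ` {z. Im z > 0})"
    using hol upper_half_plane by (intro open_mapping_thm[of f "{z. Im z > 0}"]) auto
  then obtain e where e: "e > 0" "ball (f z1) e \<subseteq> f ` {z. Im z > 0}"
    using z1 by (force simp: open_contains_ball)
  have "f z1 - \<i> * of_real (e / 2) \<in> ball (f z1) e"
    using e(1) by (simp add: dist_norm norm_mult)
  then have "f z1 - \<i> * of_real (e / 2) \<in> f ` {z. Im z > 0}" by (rule subsetD[OF e(2)])
  then obtain z where "Im z > 0" "f z = f z1 - \<i> * of_real (e / 2)" by (auto simp del: of_real_divide)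
  then show False using min[of z] e(1) by simp
qed

text \<open>If the value \<open>- \<delta>\<close> occurred, the set where the imaginary part is at
  most \<open>- \<delta>\<close> would be compact inside the open half-plane. The minimum is
  attained there, so \<open>f\<close> is constant, against the bound near \<open>0\<close>. The
  bounds are one-sided: the imaginary part may tend to plus infinity at the boundary.\<close>

lemma Im_nonneg_upper_half_plane:
  assumes hol: "f holomorphic_on {z. Im z > 0}"
    and bd: "\<And>x e. e > 0 \<Longrightarrow> \<forall>\<^sub>F z in at (complex_of_real x) within {z. Im z > 0}. Im (f z) > - e"
    and inf: "\<And>e. e > 0 \<Longrightarrow> \<forall>\<^sub>F z in at_infinity. Im z > 0 \<longrightarrow> Im (f z) > - e"
    and z: "Im z > 0"
  shows "Im (f z) \<ge> 0"
proof (rule ccontr)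
  define \<delta> where "\<delta> = - Im (f z)"
  assume "\<not> ?thesis"
  then have \<delta>: "\<delta> > 0" by (simp add: \<delta>_def)
  define K where "K = {w. Im w > 0 \<and> Im (f w) \<le> - \<delta>}"
  obtain r where r: "\<And>w. norm w \<ge> r \<Longrightarrow> Im w > 0 \<Longrightarrow> Im (f w) > - \<delta>"
    using inf[OF \<delta>] by (auto simp: eventually_at_infinity)
  have "norm w \<le> r" if "w \<in> K" for w using r[of w] that by (force simp: K_def)
  then have "bounded K" by (auto simp: bounded_iff)
  moreover have "closed K"
    unfolding closed_limpt
  proof (intro allI impI)
    fix w assume w: "w islimpt K"
    have "w islimpt {z. Im z \<ge> 0}" by (rule islimpt_subset[OF w]) (auto simp: K_def)
    then have "w \<in> {z. Im z \<ge> 0}" 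
      using closed_halfspace_Im_ge[of 0, unfolded closed_limpt, rule_format] by simp
    have *: False if ev: "\<forall>\<^sub>F v in at w within {z. Im z > 0}. Im (f v) > - \<delta>"
    proof -
      obtain d where d: "d > 0" "\<forall>v\<in>{z. Im z > 0}. v \<noteq> w \<and> dist v w < d \<longrightarrow> Im (f v) > - \<delta>"
        using ev unfolding eventually_at by blast
      obtain v where "v \<in> K" "v \<noteq> w" "dist v w < d"
        using w[unfolded islimpt_approachable, rule_format, OF d(1)] by auto
      then show False using d(2) by (auto simp: K_def)
    qed
    have "Im w > 0"
    proof (rule ccontr)
      assume "\<not> Im w > 0"
      with \<open>w \<in> {z. Im z \<ge> 0}\<close> have "w = of_real (Re w)" by (simp add: complex_eq_iff)
      then show False using * bd[OF \<delta>, of "Re w"] by simp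
    qed
    moreover have "Im (f w) \<le> - \<delta>"
    proof (rule ccontr)
      assume "\<not> Im (f w) \<le> - \<delta>"
      moreover have "((\<lambda>v. Im (f v)) \<longlongrightarrow> Im (f w)) (at w within {z. Im z > 0})"
        using holomorphic_on_imp_continuous_on[OF hol] \<open>Im w > 0\<close>
        by (intro tendsto_intros) (auto simp: continuous_on_def)
      ultimately have "\<forall>\<^sub>F v in at w within {z. Im z > 0}. Im (f v) > - \<delta>"
        by (intro order_tendstoD(1)) auto
      then show False by (rule *)
    qed
    ultimately show "w \<in> K" by (simp add: K_def)
  qed
  ultimately have "compact K" by (simp add: compact_eq_bounded_closed)
  moreover have "K \<noteq> {}" using z by (auto simp: K_def \<delta>_def)
  moreover have "continuous_on K (\<lambda>w. Im (f w))"
    by (intro continuous_intros continuous_on_subset[OF holomorphic_on_imp_continuous_on[OF hol]]) (auto simp: K_def)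
  ultimately obtain z1 where z1: "z1 \<in> K" "\<And>w. w \<in> K \<Longrightarrow> Im (f z1) \<le> Im (f w)"
    using continuous_attains_inf by metis
  have "f constant_on {z. Im z > 0}"
  proof (rule constant_if_Im_attains_min[OF hol, of z1])
    show "Im (f z1) \<le> Im (f w)" if "Im w > 0" for w
      using z1 that by (cases "w \<in> K") (auto simp: K_def)
  qed (use z1 in \<open>auto simp: K_def\<close>)
  then obtain k where k: "\<And>w. Im w > 0 \<Longrightarrow> f w = k" by (auto simp: constant_on_def)
  obtain d where d: "d > 0" "\<forall>v\<in>{z. Im z > 0}. v \<noteq> of_real 0 \<and> dist v (of_real 0) < d \<longrightarrow> Im (f v) > - \<delta>"
    using bd[OF \<delta>, of 0] unfolding eventually_at by blast
  have "Im (f (\<i> * of_real (d / 2))) > - \<delta>"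
    using d(1) by (intro d(2)[rule_format]) (auto simp: norm_mult)
  then show False using z1(1) k d(1) by (auto simp: K_def)
qed

text \<open>On a ray \<open>x + \<epsilon> \<omega>\<close> the quotient behaves like
  \<open>l * (\<epsilon> \<omega>) ^ m\<close>. The argument of \<open>\<omega> ^ m\<close> sweeps
  an interval of length \<open>m * pi\<close>, so the sign condition leaves only
  \<open>m = 1\<close>.\<close>

lemma simple_zero_of_Im_pos:
  assumes f0: "f \<noteq> 0" and fx: "poly f x = 0" and gx: "poly g x \<noteq> 0"
    and Im: "\<And>z. Im z > 0 \<Longrightarrow> Im (cpoly f z / cpoly g z) > 0"
  obtains u where "f = [:- x, 1:] * u" "poly u x / poly g x > 0"
proof -
  define m where "m = order x f"
  obtain u where u: "f = [:- x, 1:] ^ m * u" "\<not> [:- x, 1:] dvd u"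
    using order_decomp[OF f0] by (auto simp: m_def)
  have m: "m > 0" using fx f0 by (simp add: m_def order_root)
  define l where "l = poly u x / poly g x"
  have l0: "l \<noteq> 0" using u(2) gx by (simp add: l_def poly_eq_0_iff_dvd)
  have key: "Im (\<omega> ^ m * of_real l) \<ge> 0" if \<omega>: "Im \<omega> > 0" for \<omega>
  proof (rule tendsto_lowerbound)
    let ?z = "\<lambda>\<epsilon>::real. of_real x + of_real \<epsilon> * \<omega>"
    show "((\<lambda>\<epsilon>. Im (\<omega> ^ m * (cpoly u (?z \<epsilon>) / cpoly g (?z \<epsilon>)))) \<longlongrightarrow> Im (\<omega> ^ m * of_real l)) (at_right 0)"
      unfolding l_def by (auto intro!: tendsto_eq_intros simp: poly_of_real_of_real gx)
    show "\<forall>\<^sub>F \<epsilon> in at_right 0. Im (\<omega> ^ m * (cpoly u (?z \<epsilon>) / cpoly g (?z \<epsilon>))) \<ge> 0"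
    proof (rule eventually_at_right_less[THEN eventually_mono])
      fix \<epsilon> :: real assume \<epsilon>: "\<epsilon> > 0"
      have Im_scale: "Im (of_real a * w) = a * Im w" for a w by simp
      have "0 < Im (cpoly f (?z \<epsilon>) / cpoly g (?z \<epsilon>))" using \<omega> \<epsilon> by (intro Im) simp
      also have "cpoly f (?z \<epsilon>) / cpoly g (?z \<epsilon>) =
          of_real (\<epsilon> ^ m) * (\<omega> ^ m * (cpoly u (?z \<epsilon>) / cpoly g (?z \<epsilon>)))"
        by (simp add: u(1) power_mult_distrib)
      finally show "Im (\<omega> ^ m * (cpoly u (?z \<epsilon>) / cpoly g (?z \<epsilon>))) \<ge> 0"
        using \<epsilon> by (simp only: Im_scale zero_less_mult_iff) (auto simp: less_imp_le)
    qed
  qed simp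
  have cis_pow: "cis (y / m) ^ m = cis y" for y using m by (simp add: Complex.DeMoivre)
  have "m = 1"
  proof (rule ccontr)
    assume "m \<noteq> 1"
    then have m2: "real m \<ge> 2" using m by simp
    \<comment> \<open>The angles \<open>pi / 2 / m\<close> and \<open>3 * pi / 2 / m\<close> lie
      below \<open>pi\<close> for \<open>m \<ge> 2\<close>. The \<open>m\<close>-th powers are
      \<open>\<i>\<close> and \<open>- \<i>\<close>, which gives \<open>l\<close> both
      signs.\<close>
    have "Im (cis (pi / 2 / m)) > 0" using m2 by (auto intro!: sin_gt_zero simp: field_simps)
    from key[OF this] have "l \<ge> 0" unfolding cis_pow by simp
    have "pi * 3 < pi * (2 * real m)" using m2 by (intro mult_strict_left_mono) auto
    then have "Im (cis (3 * pi / 2 / m)) > 0" using m2 by (auto intro!: sin_gt_zero simp: field_simps)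
    from key[OF this] have "l * sin (3 * pi / 2) \<ge> 0" unfolding cis_pow by (simp add: mult.commute)
    moreover have "sin (3 * pi / 2) = -1" using sin_3over2_pi by (simp add: mult.commute)
    ultimately show False using \<open>l \<ge> 0\<close> l0 by simp
  qed
  moreover have "l > 0" using key[of \<i>] l0 \<open>m = 1\<close> by simp
  ultimately show ?thesis using u(1) that[of u] by (simp add: l_def)
qed

lemma cpoly_eqI:
  fixes P Q :: "real poly"
  assumes "\<And>z. Im z > 0 \<Longrightarrow> cpoly P z = cpoly Q z"
  shows "P = Q"
proof (rule ccontr)
  assume "P \<noteq> Q"
  then have nz: "map_poly complex_of_real (P - Q) \<noteq> 0" by (subst map_poly_eq_0_iff) auto
  have "{z. Im z > 0} \<subseteq> {z. cpoly (P - Q) z = 0}" using assms by auto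
  then have "finite {z. Im z > 0}" using poly_roots_finite[OF nz] finite_subset by blast
  moreover have "\<i> \<in> {z. Im z > 0}" by simp
  ultimately show False
    using finite_imp_not_open[of "{z. Im z > 0}"] upper_half_plane(1) by blast
qed

lemma eventually_Im_gt_at_real:
  assumes "poly g x \<noteq> 0" "e > 0"
  shows "\<forall>\<^sub>F z in at (complex_of_real x) within S. Im (cpoly f z / cpoly g z) > - e"
proof (rule order_tendstoD(1))
  show "((\<lambda>z. Im (cpoly f z / cpoly g z)) \<longlongrightarrow> Im (cpoly f (of_real x) / cpoly g (of_real x))) (at (of_real x) within S)"
    using assms(1) by (intro tendsto_intros) (auto simp: poly_of_real_of_real)
  show "- e < Im (cpoly f (of_real x) / cpoly g (of_real x))"
    using assms(2) by (simp add: poly_of_real_of_real flip: of_real_divide)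
qed

lemma eventually_Im_gt_at_infinity:
  assumes "degree f \<le> degree g" "g \<noteq> 0" "e > 0"
  shows "\<forall>\<^sub>F z in at_infinity. Im (cpoly f z / cpoly g z) > - e"
proof -
  define h where "h t = t ^ (degree g - degree f) * cpoly (reflect_poly f) t / cpoly (reflect_poly g) t" for t
  have refl: "cpoly p z = z ^ degree p * cpoly (reflect_poly p) (inverse z)" if "z \<noteq> 0" for p z
  proof -
    have "map_poly complex_of_real (reflect_poly p) = reflect_poly (map_poly of_real p)"
      by (rule poly_eqI) (auto simp: coeff_map_poly coeff_reflect_poly degree_map_poly)
    then show ?thesis using that
      by (simp add: poly_reflect_poly_nz degree_map_poly power_inverse)
  qed
  have h0: "cpoly (reflect_poly g) 0 \<noteq> 0"
    using assms(2) poly_of_real_of_real[of "reflect_poly g" 0] by simp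
  have "(h \<longlongrightarrow> h 0) (at 0)" unfolding h_def using h0 by (intro tendsto_intros)
  then have "isCont h 0" by (simp add: isCont_def)
  then have lim: "((\<lambda>z. Im (h (inverse z))) \<longlongrightarrow> Im (h 0)) at_infinity"
    by (intro tendsto_intros isCont_tendsto_compose[of _ h] tendsto_inverse_0)
  have "h 0 = of_real (0 ^ (degree g - degree f) * poly (reflect_poly f) 0 / poly (reflect_poly g) 0)"
    using poly_of_real_of_real[of _ 0] by (simp add: h_def)
  then have "Im (h 0) = 0" by (metis Im_complex_of_real)
  then have "\<forall>\<^sub>F z in at_infinity. Im (h (inverse z)) > - e"
    using assms(3) by (intro order_tendstoD(1)[OF lim]) simp
  moreover have "\<forall>\<^sub>F z in at_infinity. z \<noteq> (0::complex)"
    by (rule eventually_not_equal_at_infinity)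
  ultimately show ?thesis
  proof eventually_elim
    case (elim z)
    have "cpoly f z / cpoly g z = h (inverse z)"
      unfolding refl[OF elim(2), of f] refl[OF elim(2), of g] h_def
      using elim(2) assms(1) by (simp add: power_diff field_simps power_inverse)
    then show ?case using elim(1) by simp
  qed
qed

text \<open>At infinity the degrees suffice; the critical points are real poles \<open>x\<close>.
  They are simple, \<open>g = (z - x) u\<close>, and the function equals
  \<open>x * (f / g) + f / u\<close>. The first part has nonnegative imaginary part because
  \<open>x \<le> 0\<close>, the second is continuous with a real value at \<open>x\<close>. Here the
  zeros must be nonpositive and not merely real.\<close>

lemma Im_mult_nonneg_upper_half_plane:
  assumes cop: "coprime f g" and deg: "degree f < degree g"
    and roots: "only_nonpos_zeros g"
    and Im: "\<And>z. Im z > 0 \<Longrightarrow> Im (cpoly f z / cpoly g z) < 0"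
    and z: "Im z > 0"
  shows "Im (z * (cpoly f z / cpoly g z)) \<ge> 0"
proof (rule Im_nonneg_upper_half_plane[OF _ _ _ z])
  have g0: "cpoly g z \<noteq> 0" if "Im z > 0" for z
    using roots that by (auto simp: only_nonpos_zeros_def complex_is_Real_iff)
  show "(\<lambda>z. z * (cpoly f z / cpoly g z)) holomorphic_on {z. Im z > 0}"
    using g0 by (auto intro!: holomorphic_intros)
  show "\<forall>\<^sub>F z in at_infinity. 0 < Im z \<longrightarrow> - e < Im (z * (cpoly f z / cpoly g z))" if "e > 0" for e
  proof -
    have "\<forall>\<^sub>F z in at_infinity. Im (cpoly (pCons 0 f) z / cpoly g z) > - e"
      by (rule eventually_Im_gt_at_infinity) (use deg that in \<open>auto simp: degree_pCons_eq_if\<close>)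
    then show ?thesis by eventually_elim simp
  qed
  show "\<forall>\<^sub>F z in at (of_real x) within {z. 0 < Im z}. - e < Im (z * (cpoly f z / cpoly g z))" if e: "e > 0" for x e
  proof (cases "poly g x = 0")
    case False
    from eventually_Im_gt_at_real[OF this e, of "pCons 0 f"] show ?thesis by simp
  next
    case True
    have x: "x \<le> 0"
      using roots True poly_of_real_of_real[of g x] by (auto simp: only_nonpos_zeros_def)
    have fx: "poly f x \<noteq> 0"
      using cop True coprime_poly_0 by blast
    obtain u where u: "g = [:- x, 1:] * u" "poly u x / poly f x > 0"
    proof (rule simple_zero_of_Im_pos[of g x f])
      show "Im (cpoly g z / cpoly f z) > 0" if "Im z > 0" for z
        using Im[OF that] by (subst Im_divide_swap)
    qed (use True fx deg in auto)
    then have "poly u x \<noteq> 0" by auto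
    from eventually_Im_gt_at_real[OF this e, of f "{z. 0 < Im z}"]
    have "\<forall>\<^sub>F z in at (of_real x) within {z. 0 < Im z}. Im (cpoly f z / cpoly u z) > - e" .
    moreover have "\<forall>\<^sub>F z in at (of_real x) within {z. 0 < Im z}. Im z > 0"
      by (simp add: eventually_at_filter)
    ultimately show ?thesis
    proof eventually_elim
      case (elim z)
      have "cpoly g z = (z - of_real x) * cpoly u z" unfolding u(1) by (simp add: algebra_simps)
      moreover have "z - of_real x \<noteq> 0" using elim by auto
      ultimately have "(z - of_real x) * (cpoly f z / cpoly g z) = cpoly f z / cpoly u z" by simp
      then have "z * (cpoly f z / cpoly g z) = of_real x * (cpoly f z / cpoly g z) + cpoly f z / cpoly u z"
        by (simp only: left_diff_distrib diff_eq_eq add.commute)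
      moreover have "Im (of_real x * w) = x * Im w" for w by simp
      ultimately have "Im (z * (cpoly f z / cpoly g z)) = x * Im (cpoly f z / cpoly g z) + Im (cpoly f z / cpoly u z)"
        by (simp only: plus_complex.sel)
      moreover have "x * Im (cpoly f z / cpoly g z) \<ge> 0"
        using x Im[OF elim(2)] by (intro mult_nonpos_nonpos) auto
      ultimately show ?case using elim(1) by linarith
    qed
  qed
qed

text \<open>
  The condition on \<open>(P, Q)\<close> says that \<open>Q / P\<close> is a Stieltjes function of \<open>t\<close>. One step of the
  continued fraction preserves this by the minimum principle: apart from the harmless term
  \<open>c / t\<close>, the function \<open>- S / Q\<close> is \<open>- P / (t * Q)\<close>, whose imaginary part is positive.
\<close>

lemma stieltjes_imp_sfrac:
  assumes "coeff P 0 \<noteq> 0" "Q \<noteq> 0"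
    and "\<And>t. Im t > 0 \<Longrightarrow> cpoly P t \<noteq> 0"
    and "\<And>t. Im t > 0 \<Longrightarrow> Im (t * cpoly Q t / cpoly P t) > 0"
    and "\<And>t. Im t > 0 \<Longrightarrow> Im (cpoly Q t / cpoly P t) \<le> 0"
    and "degree P \<le> (m + 1) div 2" "degree Q \<le> m div 2"
  shows "\<exists>D. sfrac D P Q"
  using assms
proof (induction m arbitrary: P Q rule: less_induct)
  case (less m)
  note P0 = less.prems(1) and Q_nz = less.prems(2) and Pnz = less.prems(3)
    and tQ = less.prems(4) and Q = less.prems(5)
  have Qnz: "cpoly Q t \<noteq> 0" if "Im t > 0" for t using tQ[OF that] by auto
  define c where "c = coeff P 0 / coeff Q 0"
  \<comment> \<open>The function \<open>t Q / P\<close> vanishes at \<open>0\<close> and has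
    positive imaginary part, so this zero is simple with positive slope.\<close>
  have "coeff Q 0 / coeff P 0 > 0"
  proof (rule simple_zero_of_Im_pos[of "pCons 0 Q" 0 P])
    fix u assume "pCons 0 Q = [:- 0, 1:] * u" "poly u 0 / poly P 0 > 0"
    then show ?thesis by (simp add: poly_0_coeff_0)
  qed (use less.prems in \<open>auto simp: poly_0_coeff_0\<close>)
  then have Q0: "coeff Q 0 \<noteq> 0" and c: "c > 0" by (auto simp: c_def zero_less_divide_iff)
  from euclid_step[OF Q0, of P m]
  obtain S where S: "P = Polynomial.smult c Q + pCons 0 S"
    "degree S \<le> (m - 1) div 2" "m = 0 \<longrightarrow> S = 0" using less.prems unfolding c_def by metis
  have "\<exists>D. sfrac D Q S"
  proof (cases "S = 0")
    case True
    then show ?thesis using sfrac_base by blast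
  next
    case False
    have S_eq: "cpoly S t = (cpoly P t - of_real c * cpoly Q t) / t" if "t \<noteq> 0" for t
      using that by (subst S(1)) simp
    \<comment> \<open>Equality would make \<open>P / Q\<close> a real constant by the minimum
      principle, that is, \<open>S = 0\<close>.\<close>
    have PQ: "Im (cpoly P t / cpoly Q t) > 0" if t: "Im t > 0" for t
    proof (rule ccontr)
      assume "\<not> Im (cpoly P t / cpoly Q t) > 0"
      moreover have nn: "Im (cpoly P s / cpoly Q s) \<ge> 0" if "Im s > 0" for s
        using Q[OF that] Im_divide_swap(2)[of "cpoly Q s" "cpoly P s"] by linarith
      ultimately have t0: "Im (cpoly P t / cpoly Q t) = 0" using t by force
      have "(\<lambda>t. cpoly P t / cpoly Q t) constant_on {z. Im z > 0}"
        by (rule constant_if_Im_attains_min[OF _ t]) (use nn t0 Qnz in \<open>auto intro!: holomorphic_intros\<close>)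
      then obtain k where k: "\<And>s. Im s > 0 \<Longrightarrow> cpoly P s / cpoly Q s = k" by (auto simp: constant_on_def)
      have "Im k = 0" using k[OF t] t0 by simp
      then have kr: "k = of_real (Re k)" by (simp add: complex_eq_iff)
      have P_eq: "P = Polynomial.smult (Re k) Q"
      proof (rule cpoly_eqI)
        fix s :: complex assume "Im s > 0"
        then show "cpoly P s = cpoly (Polynomial.smult (Re k) Q) s"
          using k[of s] Qnz[of s] kr by (metis cpoly_smult nonzero_eq_divide_eq)
      qed
      have "Re k = c" unfolding c_def using Q0 by (subst P_eq) simp
      then have "pCons 0 S = 0" using P_eq S(1) by simp
      then show False using False by simp
    qed
    show ?thesis
    proof (rule less.IH[of "m - 1"])
      show "Im (t * cpoly S t / cpoly Q t) > 0" if t: "Im t > 0" for t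
      proof -
        have "t \<noteq> 0" using t by auto
        then have "t * cpoly S t / cpoly Q t = cpoly P t / cpoly Q t - of_real c"
          using Qnz[OF t] by (simp add: S_eq field_simps)
        then show ?thesis using PQ[OF t] by simp
      qed
      show "Im (cpoly S t / cpoly Q t) \<le> 0" if t: "Im t > 0" for t
      proof -
        have lower: "Im (- (cpoly S t / cpoly Q t)) > Im (of_real c / t)" if t: "Im t > 0" for t
        proof -
          have "t \<noteq> 0" using t by auto
          then have "- (cpoly S t / cpoly Q t) = of_real c / t - cpoly P t / (t * cpoly Q t)"
            using Qnz[OF t] by (simp add: S_eq field_simps)
          moreover have "Im (cpoly P t / (t * cpoly Q t)) < 0"
            using tQ[OF t] by (subst Im_divide_swap)
          ultimately show ?thesis by simp
        qed
        have "Im (- (cpoly S t / cpoly Q t)) \<ge> 0"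
        proof (rule Im_nonneg_upper_half_plane[OF _ _ _ t])
          show "(\<lambda>t. - (cpoly S t / cpoly Q t)) holomorphic_on {z. Im z > 0}"
            using Qnz by (auto intro!: holomorphic_intros)
        next
          fix x e :: real assume e: "e > 0"
          show "\<forall>\<^sub>F z in at (of_real x) within {z. Im z > 0}. Im (- (cpoly S z / cpoly Q z)) > - e"
          \<comment> \<open>Near \<open>0\<close> the bound by \<open>Im (c / t)\<close> is useless,
            being unbounded below; but \<open>Q\<close> does not vanish there, so
            \<open>S / Q\<close> is continuous with a real value.\<close>
          proof (cases "x = 0")
            case True
            then show ?thesis
              using eventually_Im_gt_at_real[of Q x e "Polynomial.smult (-1) S" "{z. Im z > 0}"] Q0 e
              by (simp add: poly_0_coeff_0)
          next
            case False
            have "\<forall>\<^sub>F z in at (of_real x) within {z. Im z > 0}. Im (of_real c / z) > - e"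
              using eventually_Im_gt_at_real[of "[:0, 1:]" x e "[:c:]" "{z. Im z > 0}"] False e by simp
            moreover have "\<forall>\<^sub>F z in at (of_real x) within {z. 0 < Im z}. Im z > 0"
              by (simp add: eventually_at_filter)
            ultimately show ?thesis by eventually_elim (use lower in fastforce)
          qed
        next
          fix e :: real assume "e > 0"
          then have "\<forall>\<^sub>F z in at_infinity. Im (of_real c / z) > - e"
            using eventually_Im_gt_at_infinity[of "[:c:]" "[:0, 1:]" e] by simp
          then show "\<forall>\<^sub>F z in at_infinity. Im z > 0 \<longrightarrow> Im (- (cpoly S z / cpoly Q z)) > - e"
            by eventually_elim (use lower in fastforce)
        qed
        then show ?thesis by simp
      qed
    qed (use False Q0 Qnz less.prems S in \<open>auto split: if_splits\<close>)
  qed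
  then obtain D where "sfrac D Q S" ..
  from sfrac_step[OF this c] have "sfrac D P Q" by (simp only: S(1)[symmetric])
  then show ?case by blast
qed

text \<open>With \<open>\<rho> = Q / P\<close>, one step yields \<open>1 / (c + t \<rho>)\<close>,
  and \<open>t\<close> times this is \<open>1 / (c / t + \<rho>)\<close>: the two sign conditions
  exchange roles. Excluding a common zero at \<open>t\<close> keeps away from zeros of
  \<open>D\<close>, and passes to the inner pair.\<close>

lemma sfrac_imp_stieltjes:
  assumes "sfrac D P Q" "Im t > 0" "cpoly P t \<noteq> 0 \<or> cpoly Q t \<noteq> 0"
  shows "cpoly P t \<noteq> 0 \<and> Im (cpoly Q t / cpoly P t) \<le> 0 \<and>
    (Q = 0 \<or> Im (t * cpoly Q t / cpoly P t) > 0)"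
  using assms(1,3)
proof (induction rule: sfrac.induct)
  case sfrac_base
  then show ?case by simp
next
  case (sfrac_step P Q c)
  define \<rho> where "\<rho> = cpoly Q t / cpoly P t"
  have t0: "t \<noteq> 0" using assms(2) by auto
  have "cpoly P t \<noteq> 0 \<or> cpoly Q t \<noteq> 0" using sfrac_step.prems by auto
  from sfrac_step.IH[OF this]
  have IH: "cpoly P t \<noteq> 0" "Im \<rho> \<le> 0" "Q = 0 \<or> Im (t * \<rho>) > 0"
    by (simp_all add: \<rho>_def)
  have 1: "cpoly (Polynomial.smult c P + pCons 0 Q) t = cpoly P t * (of_real c + t * \<rho>)"
  proof -
    have "cpoly Q t = cpoly P t * \<rho>" using IH(1) by (simp add: \<rho>_def)
    then show ?thesis by (simp add: algebra_simps)
  qed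
  have "Im (of_real c / t) < 0"
    by (subst Im_divide_swap) (use assms(2) sfrac_step.hyps in simp)
  then have neg: "Im (of_real c / t + \<rho>) < 0" using IH(2) by simp
  have 2: "of_real c + t * \<rho> = t * (of_real c / t + \<rho>)" using t0 by (simp add: distrib_left)
  have nz: "of_real c / t + \<rho> \<noteq> 0" using neg by force
  have "\<not> Im (of_real c + t * \<rho>) < 0" using IH(3) by (auto simp: \<rho>_def)
  then have "\<not> Im (1 / (of_real c + t * \<rho>)) > 0" by (subst Im_divide_swap) simp
  moreover have "Im (1 / (of_real c / t + \<rho>)) > 0"
    by (subst Im_divide_swap) (use neg in simp)
  moreover have "cpoly P t / (cpoly P t * (of_real c + t * \<rho>)) = 1 / (of_real c + t * \<rho>)"
    using IH(1) by simp
  moreover have "t * cpoly P t / (cpoly P t * (of_real c + t * \<rho>)) = 1 / (of_real c / t + \<rho>)"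
    using IH(1) t0 unfolding 2 by simp
  moreover have "cpoly P t * (of_real c + t * \<rho>) \<noteq> 0" using IH(1) t0 nz unfolding 2 by simp
  ultimately show ?case unfolding 1 by (simp only: not_less simp_thms)
qed

section \<open>Reversed polynomials and the equivalence\<close>

text \<open>The factor cancelled in lowest terms divides \<open>p\<close>, so it has no zero in the
  upper half-plane and the values there agree.\<close>

lemma R_function_neg_Fract_iff:
  assumes "\<And>z. Im z > 0 \<Longrightarrow> cpoly p z \<noteq> 0"
  shows "R_function_neg (Fract q p) \<longleftrightarrow> (\<forall>z. Im z > 0 \<longrightarrow> Im (cpoly q z / cpoly p z) < 0)"
proof -
  have p0: "p \<noteq> 0" using assms[of \<i>] by auto
  obtain N D where ND: "quot_of_fract (Fract q p) = (N, D)" by fastforce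
  have D0: "D \<noteq> 0" using snd_quot_of_fract_nonzero[of "Fract q p"] ND by simp
  have cop: "coprime N D" using coprime_quot_of_fract[of "Fract q p"] ND by simp
  have "Fract N D = Fract q p" using Fract_quot_of_fract[of "Fract q p"] ND by simp
  then have eq: "N * p = q * D" using D0 p0 by (simp add: eq_fract)
  then have "D dvd N * p" by simp
  then have "D dvd p" using cop by (simp add: coprime_commute coprime_dvd_mult_right_iff)
  then obtain g where g: "p = D * g" by (auto simp: dvd_def)
  then have "q = N * g" using eq D0 by (simp add: mult.left_commute mult.commute[of q])
  then have *: "cpoly D z \<noteq> 0" "cpoly N z / cpoly D z = cpoly q z / cpoly p z" if "Im z > 0" for z
    using assms[OF that] g by auto
  show ?thesis
    unfolding R_function_neg_def ratfun_num_def ratfun_denom_def ND fst_conv snd_conv using * by auto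
qed

lemma only_nonpos_zeros_dvd: "only_nonpos_zeros p \<Longrightarrow> d dvd p \<Longrightarrow> only_nonpos_zeros d"
  unfolding only_nonpos_zeros_def by (auto elim!: dvdE)

text \<open>Inversion preserves the negative axis, and \<open>0\<close> is an admissible zero on
  both sides, so a drop of degree under reversal does no harm.\<close>

lemma only_nonpos_zeros_reversed:
  assumes "\<And>z. z \<noteq> 0 \<Longrightarrow> cpoly p z = z ^ n * cpoly A (1 / z)"
  shows "only_nonpos_zeros p \<longleftrightarrow> only_nonpos_zeros A"
proof -
  have root: "cpoly p z = 0 \<longleftrightarrow> cpoly A (1 / z) = 0" if "z \<noteq> 0" for z
    using assms[OF that] that by simp
  have inv: "1 / z \<in> \<real> \<and> Re (1 / z) \<le> 0 \<longleftrightarrow> z \<in> \<real> \<and> Re z \<le> 0" if "z \<noteq> 0" for z :: complex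
    using that
    by (auto simp: complex_is_Real_iff Re_divide Im_divide divide_le_0_iff mult_le_0_iff power2_eq_square complex_eq_iff)
  show ?thesis
    unfolding only_nonpos_zeros_def
  proof safe
    fix z assume p: "\<forall>z. cpoly p z = 0 \<longrightarrow> z \<in> \<real> \<and> Re z \<le> 0" and z: "cpoly A z = 0"
    show "z \<in> \<real>" "Re z \<le> 0"
      using p[rule_format, of "1 / z"] root[of "1 / z"] inv[of z] z by (cases "z = 0"; simp)+
  next
    fix z assume A: "\<forall>z. cpoly A z = 0 \<longrightarrow> z \<in> \<real> \<and> Re z \<le> 0" and z: "cpoly p z = 0"
    show "z \<in> \<real>" "Re z \<le> 0"
      using A[rule_format, of "1 / z"] root[of z] inv[of z] z by (cases "z = 0"; simp)+
  qed
qed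

text \<open>Inversion alone would swap the half-planes. With \<open>z = 1 / cnj t\<close> both
  variables can stay in the upper one, and the imaginary part of the quotient changes sign.\<close>

lemma reversed_quotient:
  assumes p: "\<And>z. z \<noteq> 0 \<Longrightarrow> cpoly p z = z ^ n * cpoly A (1 / z)"
    and q: "\<And>z. z \<noteq> 0 \<Longrightarrow> cpoly q z = z ^ n * cpoly B (1 / z)"
    and "z * cnj t = 1"
  shows "cpoly q z / cpoly p z = cnj (cpoly B t / cpoly A t)" "cpoly p z = 0 \<longleftrightarrow> cpoly A t = 0"
proof -
  have "z \<noteq> 0" using assms(3) by auto
  moreover from this have "1 / z = cnj t" using assms(3) by (simp add: divide_eq_eq mult.commute)
  ultimately show "cpoly q z / cpoly p z = cnj (cpoly B t / cpoly A t)" "cpoly p z = 0 \<longleftrightarrow> cpoly A t = 0"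
    using p[of z] q[of z] by (auto simp: poly_of_real_cnj)
qed

lemma mult_cnj_eq_1_Im:
  assumes "z * cnj t = 1" "Im t > 0"
  shows "Im z > 0"
proof -
  have "cnj t \<noteq> 0" using assms(1) by auto
  then have "z = 1 / cnj t" using assms(1) by (simp add: eq_divide_eq)
  moreover have "Im (1 / cnj t) > 0" by (subst Im_divide_swap) (use assms in simp)
  ultimately show ?thesis by simp
qed

text \<open>For \<open>R = q / p\<close>, the Stieltjes conditions read \<open>Im R < 0\<close> and
  \<open>Im (z R) \<ge> 0\<close>. The second is obtained for a reduced quotient, hence the division
  by the gcd.\<close>

lemma R_function_imp_sfrac:
  assumes p: "\<And>z. z \<noteq> 0 \<Longrightarrow> cpoly p z = z ^ n * cpoly A (1 / z)"
    and q: "\<And>z. z \<noteq> 0 \<Longrightarrow> cpoly q z = z ^ n * cpoly (pCons 0 Q) (1 / z)"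
    and A0: "coeff A 0 > 0" and deg: "degree q < degree p"
    and roots: "only_nonpos_zeros p"
    and Im: "\<And>z. Im z > 0 \<Longrightarrow> Im (cpoly q z / cpoly p z) < 0"
  shows "\<exists>D. sfrac D A Q \<and> totally_nonneg (toeplitz D)"
proof -
  have p0: "cpoly p z \<noteq> 0" if "Im z > 0" for z
    using roots that by (auto simp: only_nonpos_zeros_def complex_is_Real_iff)
  define g where "g = gcd q p"
  have "p \<noteq> 0" using deg by auto
  obtain f h where fh: "q = f * g" "p = h * g" "coprime f h"
    using gcd_coprime_exists[of q p] \<open>p \<noteq> 0\<close> unfolding g_def by (metis gcd_eq_0_iff)
  have quot: "cpoly f z / cpoly h z = cpoly q z / cpoly p z" if "Im z > 0" for z
  proof -
    have "cpoly p z = cpoly h z * cpoly g z" "cpoly q z = cpoly f z * cpoly g z"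
      using fh(1,2) by (metis cpoly_mult)+
    then show ?thesis using p0[OF that] by auto
  qed
  have "q \<noteq> 0" using Im[of \<i>] by auto
  then have "degree q = degree f + degree g" "degree p = degree h + degree g"
    using fh(1,2) \<open>p \<noteq> 0\<close> by (metis degree_mult_eq mult_eq_0_iff)+
  then have deg': "degree f < degree h" using deg by simp
  have h: "only_nonpos_zeros h" using only_nonpos_zeros_dvd[OF roots] fh(2) by (metis dvd_triv_left)
  have zR: "Im (z * (cpoly q z / cpoly p z)) \<ge> 0" if "Im z > 0" for z
    using Im_mult_nonneg_upper_half_plane[OF fh(3) deg' h _ that] Im quot that by simp
  have key: "cpoly A t \<noteq> 0" "Im (t * cpoly Q t / cpoly A t) > 0" "Im (cpoly Q t / cpoly A t) \<le> 0"
    if t: "Im t > 0" for t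
  proof -
    have t0: "t \<noteq> 0" using t by auto
    define z where "z = 1 / cnj t"
    have z: "z * cnj t = 1" using t0 by (simp add: z_def)
    note Imz = mult_cnj_eq_1_Im[OF z t]
    have quot: "cpoly q z / cpoly p z = cnj (cpoly (pCons 0 Q) t / cpoly A t)" "cpoly p z = 0 \<longleftrightarrow> cpoly A t = 0"
      using reversed_quotient[of p n A q "pCons 0 Q" z t] p q z by blast+
    show "cpoly A t \<noteq> 0" using quot(2) p0[OF Imz] by simp
    have "Im (cpoly (pCons 0 Q) t / cpoly A t) > 0"
      using Im[OF Imz] by (simp only: quot(1) cnj.sel neg_less_0_iff_less)
    then show "Im (t * cpoly Q t / cpoly A t) > 0" by simp
    have eq: "z * (cpoly q z / cpoly p z) = cnj (cpoly Q t / cpoly A t)"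
      using t0 by (simp only: quot(1)) (simp add: z_def)
    show "Im (cpoly Q t / cpoly A t) \<le> 0"
      using zR[OF Imz] by (simp only: eq cnj.sel neg_0_le_iff_le)
  qed
  have "Q \<noteq> 0" using key(2)[of \<i>] by auto
  then have "\<exists>D. sfrac D A Q"
    using key A0 by (intro stieltjes_imp_sfrac[where m = "2 * (degree A + degree Q)"]) auto
  then obtain D where D: "sfrac D A Q" ..
  then have "only_nonpos_zeros D"
    using sfrac_dvd only_nonpos_zeros_dvd only_nonpos_zeros_reversed[OF p] roots by blast
  then have "totally_nonneg (toeplitz D)"
    using only_nonpos_zeros_imp_totally_nonneg_toeplitz sfrac_coeff_0_pos[OF D A0] by blast
  with D show ?thesis by blast
qed

lemma sfrac_imp_R_function:
  assumes p: "\<And>z. z \<noteq> 0 \<Longrightarrow> cpoly p z = z ^ n * cpoly A (1 / z)"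
    and q: "\<And>z. z \<noteq> 0 \<Longrightarrow> cpoly q z = z ^ n * cpoly B (1 / z)"
    and B: "B = Polynomial.smult c A + pCons 0 Q"
    and sfrac: "sfrac D A Q" and "Q \<noteq> 0"
    and p0: "cpoly p z \<noteq> 0" and z: "Im z > 0"
  shows "Im (cpoly q z / cpoly p z) < 0"
proof -
  define t where "t = 1 / cnj z"
  have z0: "z \<noteq> 0" using z by auto
  have zt: "z * cnj t = 1" using z0 by (simp add: t_def)
  have "t * cnj z = 1" using z0 by (simp add: t_def)
  note t = mult_cnj_eq_1_Im[OF this z]
  have quot: "cpoly q z / cpoly p z = cnj (cpoly B t / cpoly A t)" "cpoly p z = 0 \<longleftrightarrow> cpoly A t = 0"
    using reversed_quotient[of p n A q B z t] p q zt by blast+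
  have A0: "cpoly A t \<noteq> 0" using quot(2) p0 by simp
  have "Im (t * cpoly Q t / cpoly A t) > 0"
    using sfrac_imp_stieltjes[OF sfrac t] A0 \<open>Q \<noteq> 0\<close> by simp
  moreover have "cpoly B t / cpoly A t = of_real c + t * cpoly Q t / cpoly A t"
    unfolding B using A0 by (simp add: add_divide_distrib)
  ultimately have "Im (cpoly B t / cpoly A t) > 0" by simp
  then show ?thesis by (simp only: quot(1) cnj.sel neg_less_0_iff_less)
qed

lemma cpoly_sum_monom:
  "cpoly (\<Sum>i\<in>I. monom (f i) (d i)) z = (\<Sum>i\<in>I. of_real (f i) * z ^ d i)"
proof -
  have "map_poly complex_of_real (\<Sum>i\<in>I. monom (f i) (d i)) = (\<Sum>i\<in>I. monom (of_real (f i)) (d i))"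
    by (rule poly_eqI) (auto simp: coeff_map_poly coeff_sum intro!: sum.cong)
  then show ?thesis by (simp add: poly_sum poly_monom)
qed

lemma cpoly_reversed_sum_monom:
  assumes "z \<noteq> 0"
  shows "cpoly (\<Sum>i\<le>n. monom (a i) (n - i)) z = z ^ n * cpoly (\<Sum>i\<le>n. monom (a i) i) (1 / z)"
  unfolding cpoly_sum_monom sum_distrib_left
  using assms by (intro sum.cong) (auto simp: power_diff field_simps power_one_over)

lemma coeff_sum_monom: "coeff (\<Sum>i\<le>n. monom (a i) i) k = (if k \<le> n then a k else 0)"
  by (simp add: coeff_sum)

lemma coeff_reversed_sum_monom:
  assumes "k \<le> n"
  shows "coeff (\<Sum>i\<le>n. monom (a i) (n - i)) k = a (n - k)"
proof -
  have "coeff (\<Sum>i\<le>n. monom (a i) (n - i)) k = (\<Sum>i\<le>n. if i = n - k then a i else 0)"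
    using assms unfolding coeff_sum by (intro sum.cong) auto
  then show ?thesis by simp
qed

lemma degree_reversed_sum_monom: "degree (\<Sum>i\<le>n. monom (a i) (n - i)) \<le> n"
  by (intro degree_sum_le) (auto intro: order.trans[OF degree_monom_le])

lemma totally_nonneg_shift_matrix_imp_toeplitz:
  assumes "totally_nonneg (shift_matrix F G)"
  shows "totally_nonneg (toeplitz F)" "totally_nonneg (toeplitz G)"
proof -
  have "toeplitz F = (\<lambda>r c. shift_matrix F G (2 * r) c)" "toeplitz G = (\<lambda>r c. shift_matrix F G (Suc (2 * r)) c)"
    by (auto simp: fun_eq_iff toeplitz_def shift_matrix_def)
  then show "totally_nonneg (toeplitz F)" "totally_nonneg (toeplitz G)"
    using totally_nonneg_reindex[OF assms, of "\<lambda>r. 2 * r" "\<lambda>c. c"]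
      totally_nonneg_reindex[OF assms, of "\<lambda>r. Suc (2 * r)" "\<lambda>c. c"]
    by (simp_all add: strict_mono_def)
qed

lemma totally_nonneg_toeplitz_pCons_0:
  assumes "totally_nonneg (toeplitz (pCons 0 A))"
  shows "totally_nonneg (toeplitz A)"
proof -
  have "toeplitz A = (\<lambda>r c. toeplitz (pCons 0 A) r (Suc c))"
    by (auto simp: fun_eq_iff toeplitz_def coeff_pCons_diff)
  then show ?thesis
    using totally_nonneg_reindex[OF assms, of "\<lambda>r. r" Suc] by (simp add: strict_mono_def)
qed

lemma totally_nonneg_shift_matrix_imp_sfrac:
  assumes "totally_nonneg (shift_matrix P (pCons 0 Q))" "coeff P 0 > 0"
  shows "\<exists>D. sfrac D P Q"
  using assms totally_nonneg_imp_initial_minor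
  by (intro initial_minors_imp_sfrac[where m = "2 * (degree P + degree Q)"]) auto

lemma hurwitz_type_matrix_eq:
  defines "P \<equiv> \<lambda>n a. \<Sum>i\<le>n. monom (a i) i"
  shows "hurwitz_type_matrix n a b =
    (if b 0 = 0 then shift_matrix (P n a) (P n b) else shift_matrix (P n b) (pCons 0 (P n a)))"
proof -
  have ext: "ext_coeff n a (int c - int j) = (if j \<le> c then coeff (P n a) (c - j) else 0)" for a :: "nat \<Rightarrow> real" and c j
    by (auto simp: ext_coeff_def P_def coeff_sum_monom nat_diff_distrib simp flip: of_nat_diff)
  have ext1: "ext_coeff n a (int c - int j - 1) = (if j \<le> c then coeff (pCons 0 (P n a)) (c - j) else 0)"
    for a :: "nat \<Rightarrow> real" and c j
  proof -
    have "int c - int j - 1 = int c - int (Suc j)" by simp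
    then show ?thesis by (simp only: ext) (auto simp: coeff_pCons_diff)
  qed
  show ?thesis
    by (auto simp: fun_eq_iff hurwitz_type_matrix_def shift_matrix_def Let_def ext ext1)
qed

text \<open>The last two hypotheses exclude genuine exceptions. For \<open>p = z + 1\<close> and
  \<open>q = - z - 1 / 2\<close> the quotient is of negative type, but \<open>b 0 = - 1\<close> is a
  matrix entry; for \<open>q = p = z + 1\<close> the matrix is totally nonnegative, but the quotient
  is the constant \<open>1\<close>.\<close>

theorem theorem3p44:
  fixes n :: nat and a b :: "nat \<Rightarrow> real" and p q :: "real poly"
  assumes p: "p = (\<Sum>i\<le>n. monom (a i) (n - i))"
    and q: "q = (\<Sum>i\<le>n. monom (b i) (n - i))"
    and a0: "a 0 > 0"
    and b0: "b 0 \<ge> 0"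
    and nonconst: "\<And>c. q = Polynomial.smult c p \<Longrightarrow> c = 0"
  shows "(only_nonpos_zeros p \<and> (q = 0 \<or> only_nonpos_zeros q) \<and>
            (R_function_neg (Fract q p) \<or> Fract q p = 0))
         \<longleftrightarrow> totally_nonneg (hurwitz_type_matrix n a b)"
proof -
  define A where "A = (\<Sum>i\<le>n. monom (a i) i)"
  define B where "B = (\<Sum>i\<le>n. monom (b i) i)"
  define H where "H = hurwitz_type_matrix n a b"
  have H: "H = (if b 0 = 0 then shift_matrix A B else shift_matrix B (pCons 0 A))"
    by (simp add: H_def A_def B_def hurwitz_type_matrix_eq)
  have pA: "cpoly p z = z ^ n * cpoly A (1 / z)" and qB: "cpoly q z = z ^ n * cpoly B (1 / z)"
    if "z \<noteq> 0" for z
    using cpoly_reversed_sum_monom[OF that] by (auto simp: p q A_def B_def)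
  have A0: "coeff A 0 > 0" using a0 by (simp add: A_def coeff_sum_monom)
  then have "A \<noteq> 0" by auto
  \<comment> \<open>This is the value of \<open>q / p\<close> at infinity. Being real, it can be
    subtracted without changing imaginary parts, which lowers the degree of the numerator.\<close>
  define c where "c = b 0 / a 0"
  have "coeff (B - Polynomial.smult c A) 0 = 0" using a0 by (simp add: A_def B_def c_def coeff_sum_monom)
  then obtain Q where "B - Polynomial.smult c A = pCons 0 Q" by (metis coeff_pCons_0 pCons_cases)
  then have B: "B = Polynomial.smult c A + pCons 0 Q" by (simp add: algebra_simps)
  have coeff_p: "coeff p n = a 0" and coeff_q: "coeff q n = b 0"
    unfolding p q by (simp_all add: coeff_reversed_sum_monom)
  have deg_le: "degree p \<le> n" "degree q \<le> n" unfolding p q by (rule degree_reversed_sum_monom)+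
  have deg_p: "degree p = n" using deg_le(1) coeff_p a0 by (intro antisym le_degree) auto
  have "p \<noteq> 0" using coeff_p a0 by auto
  define q' where "q' = q - Polynomial.smult c p"
  have q': "cpoly q' z = z ^ n * cpoly (pCons 0 Q) (1 / z)" if "z \<noteq> 0" for z
    using pA[OF that] qB[OF that] B by (simp add: q'_def algebra_simps)
  have q'_0_iff: "q' = 0 \<longleftrightarrow> Q = 0"
  proof
    assume "q' = 0"
    have "pCons 0 Q = 0"
    proof (rule cpoly_eqI)
      fix t :: complex assume "Im t > 0"
      then have "t \<noteq> 0" by auto
      then show "cpoly (pCons 0 Q) t = cpoly 0 t" using q'[of "1 / t"] \<open>q' = 0\<close> by simp
    qed
    then show "Q = 0" by simp
  next
    assume "Q = 0"
    show "q' = 0"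
    proof (rule cpoly_eqI)
      fix z :: complex assume "Im z > 0"
      then have "z \<noteq> 0" by auto
      then show "cpoly q' z = cpoly 0 z" using q'[of z] \<open>Q = 0\<close> by simp
    qed
  qed
  have q'_0: "q = 0" "c = 0" if "q' = 0"
    using that nonconst[of c] by (auto simp: q'_def)
  show ?thesis
    unfolding H_def[symmetric]
  proof
    assume R: "only_nonpos_zeros p \<and> (q = 0 \<or> only_nonpos_zeros q) \<and> (R_function_neg (Fract q p) \<or> Fract q p = 0)"
    have p0: "cpoly p z \<noteq> 0" if "Im z > 0" for z
      using R that by (auto simp: only_nonpos_zeros_def complex_is_Real_iff)
    have "\<exists>D. sfrac D A Q \<and> totally_nonneg (toeplitz D)"
    proof (cases "Q = 0")
      case True
      moreover have "only_nonpos_zeros A" using R only_nonpos_zeros_reversed[OF pA] by blast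
      ultimately show ?thesis
        using sfrac_base only_nonpos_zeros_imp_totally_nonneg_toeplitz A0 by blast
    next
      case False
      have Im': "Im (cpoly q z / cpoly p z) < 0" if "Im z > 0" for z
      proof -
        have "q \<noteq> 0" using False q'_0_iff coeff_q by (auto simp: q'_def c_def)
        then have "Fract q p \<noteq> 0" using \<open>p \<noteq> 0\<close> by (simp add: Zero_fract_def eq_fract)
        then show ?thesis using R R_function_neg_Fract_iff[of p q] p0 that by blast
      qed
      show ?thesis
      proof (rule R_function_imp_sfrac[OF pA q' A0])
        have "coeff q' n = 0" using a0 by (simp add: q'_def coeff_p coeff_q c_def)
        moreover have "degree q' \<le> n"
          using deg_le by (auto simp: q'_def intro!: degree_diff_le order.trans[OF degree_smult_le])
        moreover have "q' \<noteq> 0" using False q'_0_iff by simp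
        ultimately show "degree q' < degree p" unfolding deg_p by (metis leading_coeff_0_iff le_neq_implies_less)
        show "Im (cpoly q' z / cpoly p z) < 0" if "Im z > 0" for z
          using Im'[OF that] p0[OF that] by (simp add: q'_def diff_divide_distrib)
      qed (use R in auto)
    qed
    then obtain D where D: "sfrac D A Q" "totally_nonneg (toeplitz D)" by blast
    show "totally_nonneg H"
    proof (cases "b 0 = 0")
      case True
      then have "B = pCons 0 Q" using B by (simp add: c_def)
      then show ?thesis using sfrac_imp_totally_nonneg[OF D] True by (simp add: H)
    next
      case False
      then have "c > 0" using a0 b0 by (simp add: c_def)
      from sfrac_step[OF D(1) this] have "sfrac D B A" using B by simp
      from sfrac_imp_totally_nonneg[OF this D(2)] show ?thesis using False by (simp add: H)
    qed
  next
    assume TN: "totally_nonneg H"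
    have TA: "totally_nonneg (toeplitz A)" and TB: "totally_nonneg (toeplitz B)"
      and sfrac: "\<exists>D. sfrac D A Q"
    proof -
      have "totally_nonneg (toeplitz A) \<and> totally_nonneg (toeplitz B) \<and> (\<exists>D. sfrac D A Q)"
      proof (cases "b 0 = 0")
        case True
        then have "B = pCons 0 Q" using B by (simp add: c_def)
        then show ?thesis
          using TN True totally_nonneg_shift_matrix_imp_toeplitz totally_nonneg_shift_matrix_imp_sfrac A0
          by (auto simp: H)
      next
        case False
        then have TN': "totally_nonneg (shift_matrix B (pCons 0 A))" using TN by (simp add: H)
        have "coeff B 0 > 0" using False b0 by (simp add: B_def coeff_sum_monom)
        then obtain D where "sfrac D B A" using totally_nonneg_shift_matrix_imp_sfrac[OF TN'] by blast
        \<comment> \<open>The outermost step is unique: constant coefficients identify its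
          coefficient with \<open>c\<close>, and then its remainder with \<open>Q\<close>.\<close>
        then have "sfrac D A Q"
        proof cases
          case sfrac_base
          then show ?thesis using \<open>A \<noteq> 0\<close> by simp
        next
          case (sfrac_step Q' c')
          have "c * coeff A 0 = c' * coeff A 0"
            using arg_cong[OF sfrac_step(1), of "\<lambda>P. coeff P 0"] B by simp
          then have "c' = c" using A0 by simp
          then have "Q' = Q" using sfrac_step(1) B by simp
          then show ?thesis using sfrac_step by simp
        qed
        then show ?thesis
          using totally_nonneg_shift_matrix_imp_toeplitz[OF TN'] totally_nonneg_toeplitz_pCons_0 by blast
      qed
      then show "totally_nonneg (toeplitz A)" "totally_nonneg (toeplitz B)" "\<exists>D. sfrac D A Q" by auto
    qed
    have rA: "only_nonpos_zeros p"
      using totally_nonneg_toeplitz_imp_only_nonpos_zeros[OF TA \<open>A \<noteq> 0\<close>] only_nonpos_zeros_reversed[OF pA] by blast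
    moreover have "only_nonpos_zeros q" if "q \<noteq> 0"
    proof -
      have "B \<noteq> 0"
      proof
        assume "B = 0"
        have "q = 0"
        proof (rule cpoly_eqI)
          fix z :: complex assume "Im z > 0"
          then have "z \<noteq> 0" by auto
          then show "cpoly q z = cpoly 0 z" using qB[of z] \<open>B = 0\<close> by simp
        qed
        with that show False by simp
      qed
      then show ?thesis
        using totally_nonneg_toeplitz_imp_only_nonpos_zeros[OF TB] only_nonpos_zeros_reversed[OF qB] by blast
    qed
    moreover have "R_function_neg (Fract q p)" if "q \<noteq> 0"
    proof -
      have p0: "cpoly p z \<noteq> 0" if "Im z > 0" for z
        using rA that by (auto simp: only_nonpos_zeros_def complex_is_Real_iff)
      \<comment> \<open>If \<open>Q\<close> were zero, \<open>q\<close> would be a multiple of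
        \<open>p\<close>, and \<open>nonconst\<close> would give \<open>q = 0\<close>.\<close>
      have "Q \<noteq> 0" using q'_0 q'_0_iff that by blast
      then show ?thesis
        using R_function_neg_Fract_iff[of p q] sfrac_imp_R_function[OF pA qB B] sfrac p0 by blast
    qed
    moreover have "Fract q p = 0" if "q = 0" using that by (simp add: Zero_fract_def eq_fract)
    ultimately show "only_nonpos_zeros p \<and> (q = 0 \<or> only_nonpos_zeros q) \<and> (R_function_neg (Fract q p) \<or> Fract q p = 0)"
      by blast
  qed
qed

end
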